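(* Let $X=L^2[0,1]$, let $V:X\to X$ be the Volterra integration operator $(Vx)(t)=\int_0^tx$, let $T=V^{-1}$, and let $S:=\tfrac{T-T^*}{2}$, with $\operatorname{dom}S=\operatorname{dom}T\cap\operatorname{dom}T^*$. Let $e\equiv1\in L^2[0,1]$ and $e^\perp=\{y\in X:\langle e,y\rangle=0\}$. (i) $Sx=x'$ for all $x\in\operatorname{dom}S$, and $\operatorname{gra}S=\{(Vx,x)\mid x\in e^\perp\}$. In particular, $$\operatorname{dom}S=\{x\in L^2[0,1]: x\text{ is absolutely continuous},\ x(0)=x(1)=0,\ x'\in L^2[0,1]\},$$ $$\operatorname{ran}S=\{y\in L^2[0,1]:\langle e,y\rangle=0\}=e^\perp.$$ Moreover, $\operatorname{dom}S$ is dense, and $$S^{-1}=V|_{e^\perp},\qquad(-S)^{-1}=V^*|_{e^\perp};$$ consequently, $S$ is skew, and neither $S$ nor $-S$ is maximal monotone. (ii) The adjoint of $S$ has $\operatorname{gra}S^*=\{(V^*x^*+le,x^* )\mid x^*\in X,\ l\in\mathbb{R}\}$. More precisely, $S^*x=-x'$ for all $x\in\operatorname{dom}S^*$, with $$\operatorname{dom}S^*=\{x\in L^2[0,1]: x\text{ is absolutely continuous on }[0,1],\ x'\in L^2[0,1]\},\qquad\operatorname{ran}S^*=L^2[0,1].$$ Neither $S^*$ nor $-S^*$ is monotone. Moreover, $S^{**}=S$. (iii) Let $T_1:\operatorname{dom}T_1\to X$ be defined by $T_1x=x'$ for all $$x\in\operatorname{dom}T_1:=\{x\in L^2[0,1]: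 x\text{ is absolutely continuous},\ x(0)=x(1),\ x'\in L^2[0,1]\}.$$ Then $T_1^*=-T_1$ and $\operatorname{ran}T_1=e^\perp$. Hence $T_1$ is skew and a maximal monotone extension of $S$; and $-T_1$ is skew and a maximal monotone extension of $-S$.
   Context: $L^2[0,1]$ is the real Hilbert space of (classes of) square-integrable real functions on $[0,1]$ with inner product $\langle x,y\rangle=\int_0^1xy$. An element is called absolutely continuous if it has an absolutely continuous representative on $[0,1]$; point values $x(0),x(1)$ refer to that representative, and $x'$ is its (a.e.) derivative. The operator $V$ is injective, and its adjoint is $(V^*x)(t)=\int_t^1x$. For a set-valued operator $A:X\rightrightarrows X$, $\operatorname{gra}A=\{(x,x^* )\in X\times X\mid x^*\in Ax\}$, $\operatorname{dom}A=\{x\mid Ax\ne\varnothing\}$, $\operatorname{ran}A=\bigcup_xAx$, and $A^{-1}$ is the operator with graph $\{(x^*,x)\mid(x,x^* )\in\operatorname{gra}A\}$. At most single-valued linear relations (operators whose graph is a linear subspace) are identified with linear operators on their domains. $A$ is monotone if $\langle x-y,x^*-y^*\rangle\ge0$ for all $(x,x^* ),(y,y^* )\in\operatorname{gra}A$, and maximal monotone if monotone with no proper monotone enlargement (in the sense of graph inclusion); $B$ is a maximal monotone extension of $A$ if $B$ is maximal monotone and $\operatorname{gra}B\supseteq\operatorname{gra}A$. For a linear relation $A$, the adjoint $A^*$ is defined by $\operatorname{gra}A^*=\{(x,x^* )\mid(x^*,-x)\in(\operatorname{gra}A)^\perp\}$, and $A$ is skew if $\langle x,x^*\rangle=0$ for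 all $(x,x^* )\in\operatorname{gra}A$. *)

theory Defs
  imports "HOL-Analysis.Analysis"
begin

section \<open>The space \<open>L\<^sup>2[0,1]\<close>\<close>

abbreviation leb01 :: "real measure" where
  "leb01 \<equiv> lebesgue_on {0..1}"

definition square_integrable :: "(real \<Rightarrow> real) \<Rightarrow> bool" where
  "square_integrable f \<longleftrightarrow>
     f \<in> borel_measurable leb01 \<and> integrable leb01 (\<lambda>t. (f t)\<^sup>2)"

lemma finite_measure_leb01: "finite_measure leb01"
  by (intro finite_measureI) (simp add: emeasure_restrict_space)

lemma square_integrable_mult:
  assumes "square_integrable f" "square_integrable g"
  shows "integrable leb01 (\<lambda>t. f t * g t)"
proof (rule Bochner_Integration.integrable_bound)
  show "integrable leb01 (\<lambda>t. (f t)\<^sup>2 + (g t)\<^sup>2)"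
    using assms by (simp add: square_integrable_def)
  show "(\<lambda>t. f t * g t) \<in> borel_measurable leb01"
    using assms by (auto simp: square_integrable_def intro: borel_measurable_times)
  have "\<bar>a * b\<bar> \<le> a\<^sup>2 + b\<^sup>2" for a b :: real
  proof -
    have "2 * \<bar>a * b\<bar> \<le> a\<^sup>2 + b\<^sup>2"
      using sum_squares_bound[of "\<bar>a\<bar>" "\<bar>b\<bar>"] by (simp add: abs_mult)
    then show ?thesis by simp
  qed
  then show "AE t in leb01. norm (f t * g t) \<le> norm ((f t)\<^sup>2 + (g t)\<^sup>2)"
    by (intro AE_I2) simp
qed

lemma square_integrable_add:
  assumes "square_integrable f" "square_integrable g"
  shows "square_integrable (\<lambda>t. f t + g t)"
  using assms square_integrable_mult[OF assms]
  by (auto simp: square_integrable_def power2_sum mult.assoc intro: borel_measurable_add)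

lemma square_integrable_scale:
  "square_integrable f \<Longrightarrow> square_integrable (\<lambda>t. c * f t)"
  by (auto simp: square_integrable_def power_mult_distrib intro: borel_measurable_times)

lemma square_integrable_minus:
  "square_integrable f \<Longrightarrow> square_integrable (\<lambda>t. - f t)"
  by (simp add: square_integrable_def)

lemma square_integrable_const: "square_integrable (\<lambda>t. c)"
  using finite_measure.integrable_const[OF finite_measure_leb01]
  by (simp add: square_integrable_def)

lemma square_integrable_integrable: "square_integrable f \<Longrightarrow> integrable leb01 f"
  using square_integrable_mult[OF _ square_integrable_const[of 1], of f] by simp

quotient_type L2 = "real \<Rightarrow> real" / partial:
  "\<lambda>f g. square_integrable f \<and> square_integrable g \<and> (AE t in leb01. f t = g t)"
proof (rule part_equivpI)
  show "\<exists>f. square_integrable f \<and> square_integrable f \<and> (AE t in leb01. f t = f t)"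
    using square_integrable_const by auto
  show "symp (\<lambda>f g. square_integrable f \<and> square_integrable g \<and> (AE t in leb01. f t = g t))"
    by (auto simp: symp_def elim: eventually_mono)
  show "transp (\<lambda>f g. square_integrable f \<and> square_integrable g \<and> (AE t in leb01. f t = g t))"
    unfolding transp_def
  proof (intro allI impI conjI)
    fix f g h :: "real \<Rightarrow> real"
    assume "square_integrable f \<and> square_integrable g \<and> (AE t in leb01. f t = g t)"
      "square_integrable g \<and> square_integrable h \<and> (AE t in leb01. g t = h t)"
    then have "AE t in leb01. f t = g t" "AE t in leb01. g t = h t"
      by blast+
    then show "AE t in leb01. f t = h t"
      by eventually_elim simp
  qed simp_all
qed

instantiation L2 :: real_inner
begin

lift_definition zero_L2 :: L2 is "\<lambda>t. 0"
  by (simp add: square_integrable_const)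

lift_definition plus_L2 :: "L2 \<Rightarrow> L2 \<Rightarrow> L2" is "\<lambda>f g t. f t + g t"
  by (auto intro: square_integrable_add elim: eventually_elim2)

lift_definition uminus_L2 :: "L2 \<Rightarrow> L2" is "\<lambda>f t. - f t"
  by (auto intro: square_integrable_minus elim: eventually_mono)

definition minus_L2 :: "L2 \<Rightarrow> L2 \<Rightarrow> L2" where
  "minus_L2 x y = x + - y"

lift_definition scaleR_L2 :: "real \<Rightarrow> L2 \<Rightarrow> L2" is "\<lambda>c f t. c * f t"
  by (auto intro: square_integrable_scale elim: eventually_mono)

lift_definition inner_L2 :: "L2 \<Rightarrow> L2 \<Rightarrow> real" is "\<lambda>f g. LINT t|leb01. f t * g t"
proof -
  fix f f' g g' :: "real \<Rightarrow> real"
  assume f: "square_integrable f \<and> square_integrable f' \<and> (AE t in leb01. f t = f' t)"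
    and g: "square_integrable g \<and> square_integrable g' \<and> (AE t in leb01. g t = g' t)"
  have "AE t in leb01. f t * g t = f' t * g' t"
    using f g by (auto elim: eventually_elim2)
  then show "(LINT t|leb01. f t * g t) = (LINT t|leb01. f' t * g' t)"
    using f g by (intro integral_cong_AE) (auto simp: square_integrable_def)
qed

definition norm_L2 :: "L2 \<Rightarrow> real" where
  "norm_L2 x = sqrt (x \<bullet> x)"

definition sgn_L2 :: "L2 \<Rightarrow> L2" where
  "sgn_L2 x = inverse (norm x) *\<^sub>R x"

definition dist_L2 :: "L2 \<Rightarrow> L2 \<Rightarrow> real" where
  "dist_L2 x y = norm (x - y)"

definition uniformity_L2 :: "(L2 \<times> L2) filter" where
  "uniformity_L2 = (INF e\<in>{0<..}. principal {(x, y). dist x y < e})"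

definition open_L2 :: "L2 set \<Rightarrow> bool" where
  "open_L2 U = (\<forall>x\<in>U. \<forall>\<^sub>F (x', y) in uniformity. x' = x \<longrightarrow> y \<in> U)"

instance
proof
  fix x y z :: L2 and a b c :: real
  show "x + y + z = x + (y + z)"
    by transfer (auto simp: add.assoc intro!: square_integrable_add)
  show "x + y = y + x"
    by transfer (auto simp: add.commute intro!: square_integrable_add)
  show "0 + x = x"
    by transfer auto
  show "- x + x = 0"
    by transfer (auto simp: square_integrable_const)
  show "x - y = x + - y"
    by (rule minus_L2_def)
  show "a *\<^sub>R (x + y) = a *\<^sub>R x + a *\<^sub>R y"
    by transfer
      (auto simp: distrib_left intro!: square_integrable_add square_integrable_scale)
  show "(a + b) *\<^sub>R x = a *\<^sub>R x + b *\<^sub>R x"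
    by transfer
      (auto simp: distrib_right intro!: square_integrable_add square_integrable_scale)
  show "a *\<^sub>R b *\<^sub>R x = (a * b) *\<^sub>R x"
    by transfer (auto simp: mult.assoc intro!: square_integrable_scale)
  show "1 *\<^sub>R x = x"
    by transfer auto
  show "dist x y = norm (x - y)"
    by (rule dist_L2_def)
  show "sgn x = inverse (norm x) *\<^sub>R x"
    by (rule sgn_L2_def)
  show "uniformity = (INF e\<in>{0<..}. principal {(x :: L2, y). dist x y < e})"
    by (rule uniformity_L2_def)
  show "open U = (\<forall>x\<in>U. \<forall>\<^sub>F (x', y) in uniformity. x' = x \<longrightarrow> y \<in> U)" for U :: "L2 set"
    by (rule open_L2_def)
  show "x \<bullet> y = y \<bullet> x"
    by transfer (simp add: mult.commute)
  show "(x + y) \<bullet> z = x \<bullet> z + y \<bullet> z"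
    by transfer (simp add: distrib_right square_integrable_mult)
  show "(c *\<^sub>R x) \<bullet> y = c * (x \<bullet> y)"
    by transfer (simp add: mult.assoc)
  show "0 \<le> x \<bullet> x"
    by transfer simp
  show "x \<bullet> x = 0 \<longleftrightarrow> x = 0"
  proof transfer
    fix f :: "real \<Rightarrow> real"
    assume f: "square_integrable f \<and> square_integrable f \<and> (AE t in leb01. f t = f t)"
    then have "(LINT t|leb01. (f t)\<^sup>2) = 0 \<longleftrightarrow> (AE t in leb01. (f t)\<^sup>2 = 0)"
      by (intro integral_nonneg_eq_0_iff_AE) (auto simp: square_integrable_def)
    then show "(LINT t|leb01. f t * f t) = 0 \<longleftrightarrow>
        square_integrable f \<and> square_integrable (\<lambda>t. 0) \<and> (AE t in leb01. f t = 0)"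
      using f by (simp add: power2_eq_square square_integrable_const)
  qed
  show "norm x = sqrt (x \<bullet> x)"
    by (rule norm_L2_def)
qed

end

lift_definition represents :: "(real \<Rightarrow> real) \<Rightarrow> L2 \<Rightarrow> bool" is
  "\<lambda>f g. square_integrable f \<and> (AE t in leb01. f t = g t)"
  by (auto elim: eventually_elim2)

lemma represents_unique: "represents f x \<Longrightarrow> represents f y \<Longrightarrow> x = y"
  by transfer (auto elim: eventually_elim2)

lift_definition const_L2 :: "real \<Rightarrow> L2" is "\<lambda>c t. c"
  by (simp add: square_integrable_const)

section \<open>The Volterra operator\<close>

lemma volterra_integral_restrict:
  fixes f :: "real \<Rightarrow> real"
  assumes "t \<le> 1"
  shows "(LINT s:{0..t}|lebesgue. f s) = (LINT s|leb01. indicator {0..t} s * f s)"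
proof -
  have "(LINT s|leb01. indicator {0..t} s * f s)
      = (LINT s|lebesgue. indicator {0..1} s *\<^sub>R (indicator {0..t} s * f s))"
    by (subst Bochner_Integration.integral_restrict_space) simp_all
  also have "\<dots> = (LINT s:{0..t}|lebesgue. f s)"
    unfolding set_lebesgue_integral_def
    using assms by (intro Bochner_Integration.integral_cong) (auto simp: indicator_def)
  finally show ?thesis by simp
qed

lemma volterra_adj_integral_restrict:
  fixes f :: "real \<Rightarrow> real"
  assumes "0 \<le> t"
  shows "(LINT s:{t..1}|lebesgue. f s) = (LINT s|leb01. indicator {t..1} s * f s)"
proof -
  have "(LINT s|leb01. indicator {t..1} s * f s)
      = (LINT s|lebesgue. indicator {0..1} s *\<^sub>R (indicator {t..1} s * f s))"
    by (subst Bochner_Integration.integral_restrict_space) simp_all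
  also have "\<dots> = (LINT s:{t..1}|lebesgue. f s)"
    unfolding set_lebesgue_integral_def
    using assms by (intro Bochner_Integration.integral_cong) (auto simp: indicator_def)
  finally show ?thesis by simp
qed

lemma sigma_finite_leb01: "sigma_finite_measure leb01"
  by (rule finite_measure.axioms(1)[OF finite_measure_leb01])

lemma pair_sigma_finite_leb01: "pair_sigma_finite leb01 leb01"
  by (simp add: pair_sigma_finite_def sigma_finite_leb01)

lemma borel_measurable_leb01_pair:
  "(\<lambda>p. fst p) \<in> borel_measurable (leb01 \<Otimes>\<^sub>M leb01)"
  "(\<lambda>p. snd p) \<in> borel_measurable (leb01 \<Otimes>\<^sub>M leb01)"
proof -
  have id: "(\<lambda>x. x) \<in> borel_measurable leb01"
    by (intro measurable_restrict_space1 measurable_completion) simp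
  show "(\<lambda>p. fst p) \<in> borel_measurable (leb01 \<Otimes>\<^sub>M leb01)"
    by (rule measurable_compose[OF measurable_fst id])
  show "(\<lambda>p. snd p) \<in> borel_measurable (leb01 \<Otimes>\<^sub>M leb01)"
    by (rule measurable_compose[OF measurable_snd id])
qed

lemma square_integrable_kernel:
  assumes f: "square_integrable f"
    and K: "K \<in> borel_measurable (leb01 \<Otimes>\<^sub>M leb01)"
    and bd: "\<And>p. \<bar>K p\<bar> \<le> 1"
    and F: "\<And>t. t \<in> {0..1} \<Longrightarrow> F t = (LINT s|leb01. K (t, s) * f s)"
  shows "square_integrable F"
proof -
  interpret M: finite_measure leb01 by (rule finite_measure_leb01)
  have fi: "integrable leb01 f" and fm: "f \<in> borel_measurable leb01"
    using f square_integrable_integrable[OF f] by (simp_all add: square_integrable_def)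
  have meas: "(\<lambda>(t, s). K (t, s) * f s) \<in> borel_measurable (leb01 \<Otimes>\<^sub>M leb01)"
    using borel_measurable_times[OF K measurable_compose[OF measurable_snd fm]]
    by (simp add: case_prod_beta')
  let ?G = "\<lambda>t. LINT s|leb01. K (t, s) * f s"
  have G: "?G \<in> borel_measurable leb01"
    by (rule sigma_finite_measure.borel_measurable_lebesgue_integral[OF sigma_finite_leb01 meas])
  have bound: "\<bar>?G t\<bar> \<le> (LINT s|leb01. \<bar>f s\<bar>)" for t
  proof (cases "integrable leb01 (\<lambda>s. K (t, s) * f s)")
    case True
    have "\<bar>?G t\<bar> \<le> (LINT s|leb01. \<bar>K (t, s) * f s\<bar>)"
      using integral_abs_bound by blast
    also have "\<dots> \<le> (LINT s|leb01. \<bar>f s\<bar>)"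
    proof (rule integral_mono)
      fix s
      show "\<bar>K (t, s) * f s\<bar> \<le> \<bar>f s\<bar>"
        using bd[of "(t, s)"] by (simp add: abs_mult mult_left_le_one_le)
    qed (use True fi in simp_all)
    finally show ?thesis .
  qed (simp add: not_integrable_integral_eq)
  have "integrable leb01 (\<lambda>t. (?G t)\<^sup>2)"
  proof (rule M.integrable_const_bound)
    show "AE t in leb01. norm ((?G t)\<^sup>2) \<le> (LINT s|leb01. \<bar>f s\<bar>)\<^sup>2"
    proof (rule AE_I2)
      fix t
      show "norm ((?G t)\<^sup>2) \<le> (LINT s|leb01. \<bar>f s\<bar>)\<^sup>2"
        using power_mono[OF bound[of t], of 2] by simp
    qed
    show "(\<lambda>t. (?G t)\<^sup>2) \<in> borel_measurable leb01"
      using G by (rule borel_measurable_power)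
  qed
  then have "square_integrable ?G"
    using G by (simp add: square_integrable_def)
  moreover have "?G \<in> borel_measurable leb01 \<longleftrightarrow> F \<in> borel_measurable leb01"
    using F by (intro measurable_cong) simp
  moreover have "integrable leb01 (\<lambda>t. (?G t)\<^sup>2) \<longleftrightarrow> integrable leb01 (\<lambda>t. (F t)\<^sup>2)"
    using F by (intro Bochner_Integration.integrable_cong) simp_all
  ultimately show ?thesis
    by (simp add: square_integrable_def)
qed

lemma kernel_measurable:
  "(\<lambda>p. indicator {0..fst p} (snd p) :: real) \<in> borel_measurable (leb01 \<Otimes>\<^sub>M leb01)"
  "(\<lambda>p. indicator {fst p..1} (snd p) :: real) \<in> borel_measurable (leb01 \<Otimes>\<^sub>M leb01)"
proof -
  have eq: "(\<lambda>p. indicator {0..fst p} (snd p) :: real)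
        = (\<lambda>p. if 0 \<le> snd p \<and> snd p \<le> fst p then 1 else 0)"
      "(\<lambda>p. indicator {fst p..1} (snd p) :: real)
        = (\<lambda>p. if fst p \<le> snd p \<and> snd p \<le> 1 then 1 else 0)"
    by (auto simp: indicator_def)
  show "(\<lambda>p. indicator {0..fst p} (snd p) :: real) \<in> borel_measurable (leb01 \<Otimes>\<^sub>M leb01)"
    "(\<lambda>p. indicator {fst p..1} (snd p) :: real) \<in> borel_measurable (leb01 \<Otimes>\<^sub>M leb01)"
    unfolding eq
    by (intro measurable_If sets.sets_Collect_conj borel_measurable_le
        borel_measurable_leb01_pair borel_measurable_const)+
qed

lemma kernel_cong:
  assumes "square_integrable f" "square_integrable g" "AE s in leb01. f s = g s"
    and "A \<in> sets lebesgue"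
  shows "(LINT s|leb01. indicator A s * f s) = (LINT s|leb01. indicator A s * g s)"
proof (rule integral_cong_AE)
  have A: "(indicator A :: real \<Rightarrow> real) \<in> borel_measurable leb01"
    using assms(4) by (intro measurable_restrict_space1) simp
  show "(\<lambda>s. indicator A s * f s) \<in> borel_measurable leb01"
    "(\<lambda>s. indicator A s * g s) \<in> borel_measurable leb01"
    using assms(1,2) A by (auto simp: square_integrable_def intro: borel_measurable_times)
  show "AE s in leb01. indicator A s * f s = indicator A s * g s"
    using assms(3) by (auto elim: eventually_mono)
qed

lift_definition volterra :: "L2 \<Rightarrow> L2" is "\<lambda>f t. LINT s:{0..t}|lebesgue. f s"
proof -
  fix f g :: "real \<Rightarrow> real"
  assume fg: "square_integrable f \<and> square_integrable g \<and> (AE t in leb01. f t = g t)"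
  have si: "square_integrable (\<lambda>t. LINT s:{0..t}|lebesgue. h s)" if "square_integrable h" for h
  proof (rule square_integrable_kernel[OF that kernel_measurable(1)])
  qed (simp_all add: volterra_integral_restrict)
  have "AE t in leb01. (LINT s:{0..t}|lebesgue. f s) = (LINT s:{0..t}|lebesgue. g s)"
  proof (rule AE_I2)
    fix t assume "t \<in> space leb01"
    then have "0 \<le> t" "t \<le> 1" by simp_all
    then show "(LINT s:{0..t}|lebesgue. f s) = (LINT s:{0..t}|lebesgue. g s)"
      using kernel_cong[of f g "{0..t}"] fg by (simp only: volterra_integral_restrict) simp
  qed
  then show "square_integrable (\<lambda>t. LINT s:{0..t}|lebesgue. f s) \<and>
      square_integrable (\<lambda>t. LINT s:{0..t}|lebesgue. g s) \<and>
      (AE t in leb01. (LINT s:{0..t}|lebesgue. f s) = (LINT s:{0..t}|lebesgue. g s))"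
    by (intro conjI si[of f] si[of g]) (simp_all only: fg)
qed

lift_definition volterra_adj :: "L2 \<Rightarrow> L2" is "\<lambda>f t. LINT s:{t..1}|lebesgue. f s"
proof -
  fix f g :: "real \<Rightarrow> real"
  assume fg: "square_integrable f \<and> square_integrable g \<and> (AE t in leb01. f t = g t)"
  have si: "square_integrable (\<lambda>t. LINT s:{t..1}|lebesgue. h s)" if "square_integrable h" for h
  proof (rule square_integrable_kernel[OF that kernel_measurable(2)])
  qed (simp_all add: volterra_adj_integral_restrict)
  have "AE t in leb01. (LINT s:{t..1}|lebesgue. f s) = (LINT s:{t..1}|lebesgue. g s)"
  proof (rule AE_I2)
    fix t assume "t \<in> space leb01"
    then have "0 \<le> t" "t \<le> 1" by simp_all
    then show "(LINT s:{t..1}|lebesgue. f s) = (LINT s:{t..1}|lebesgue. g s)"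
      using kernel_cong[of f g "{t..1}"] fg by (simp only: volterra_adj_integral_restrict) simp
  qed
  then show "square_integrable (\<lambda>t. LINT s:{t..1}|lebesgue. f s) \<and>
      square_integrable (\<lambda>t. LINT s:{t..1}|lebesgue. g s) \<and>
      (AE t in leb01. (LINT s:{t..1}|lebesgue. f s) = (LINT s:{t..1}|lebesgue. g s))"
    by (intro conjI si[of f] si[of g]) (simp_all only: fg)
qed

lemma inner_volterra: "volterra x \<bullet> y = x \<bullet> volterra_adj y"
proof transfer
  fix f g :: "real \<Rightarrow> real"
  assume "square_integrable f \<and> square_integrable f \<and> (AE t in leb01. f t = f t)"
    and "square_integrable g \<and> square_integrable g \<and> (AE t in leb01. g t = g t)"
  then have f: "square_integrable f" and g: "square_integrable g"
    by blast+
  have fi: "integrable leb01 f" and gi: "integrable leb01 g"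
    by (rule square_integrable_integrable[OF f] square_integrable_integrable[OF g])+
  have fm: "f \<in> borel_measurable leb01" and gm: "g \<in> borel_measurable leb01"
    using f g by (simp_all add: square_integrable_def)
  interpret P: pair_sigma_finite leb01 leb01
    by (rule pair_sigma_finite_leb01)
  have int: "integrable (leb01 \<Otimes>\<^sub>M leb01) (\<lambda>(t, s). indicator {0..t} s * (f s * g t))"
  proof (rule Bochner_Integration.integrable_bound)
    show "integrable (leb01 \<Otimes>\<^sub>M leb01) (\<lambda>(t, s). g t * f s)"
    proof (rule P.Fubini_integrable)
      show "AE t in leb01. integrable leb01 (\<lambda>s. case (t, s) of (t, s) \<Rightarrow> g t * f s)"
        using fi by simp
      show "integrable leb01 (\<lambda>t. LINT s|leb01. norm (case (t, s) of (t, s) \<Rightarrow> g t * f s))"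
        using gi by (simp add: abs_mult)
      show "(\<lambda>(t, s). g t * f s) \<in> borel_measurable (leb01 \<Otimes>\<^sub>M leb01)"
        using borel_measurable_times[OF measurable_compose[OF measurable_fst gm]
            measurable_compose[OF measurable_snd fm]]
        by (simp add: case_prod_beta')
    qed
    have "(\<lambda>p. indicator {0..fst p} (snd p) * (f (snd p) * g (fst p)))
        \<in> borel_measurable (leb01 \<Otimes>\<^sub>M leb01)"
      by (intro borel_measurable_times kernel_measurable measurable_compose[OF measurable_fst gm]
          measurable_compose[OF measurable_snd fm])
    then show "(\<lambda>(t, s). indicator {0..t} s * (f s * g t)) \<in> borel_measurable (leb01 \<Otimes>\<^sub>M leb01)"
      by (simp add: case_prod_beta')
  qed (auto simp: indicator_def mult.commute)
  have "(LINT t|leb01. (LINT s:{0..t}|lebesgue. f s) * g t)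
      = (LINT t|leb01. LINT s|leb01. indicator {0..t} s * (f s * g t))"
    by (intro Bochner_Integration.integral_cong)
      (auto simp: volterra_integral_restrict mult.assoc simp flip: integral_mult_left_zero)
  also have "\<dots> = (LINT s|leb01. LINT t|leb01. indicator {0..t} s * (f s * g t))"
    using P.Fubini_integral[OF int] by simp
  also have "\<dots> = (LINT s|leb01. f s * (LINT t:{s..1}|lebesgue. g t))"
  proof (rule Bochner_Integration.integral_cong[OF refl])
    fix s assume "s \<in> space leb01"
    then have s: "0 \<le> s" "s \<le> 1" by auto
    have "(LINT t|leb01. indicator {0..t} s * (f s * g t))
        = (LINT t|leb01. f s * (indicator {s..1} t * g t))"
      using s by (intro Bochner_Integration.integral_cong) (auto simp: indicator_def)
    then show "(LINT t|leb01. indicator {0..t} s * (f s * g t))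
        = f s * (LINT t:{s..1}|lebesgue. g t)"
      using s by (simp add: volterra_adj_integral_restrict)
  qed
  finally show "(LINT t|leb01. (LINT s:{0..t}|lebesgue. f s) * g t)
      = (LINT s|leb01. f s * (LINT t:{s..1}|lebesgue. g t))" .
qed

lemma adjoint_volterra: "adjoint volterra = volterra_adj"
  by (intro adjoint_unique allI inner_volterra)

section \<open>Absolute continuity and the a.e. derivative\<close>

text \<open>A division is a finite family of nonoverlapping compact intervals; \<open>Inf\<close> and \<open>Sup\<close> pick
  their endpoints.\<close>

definition absolutely_continuous_on :: "real \<Rightarrow> real \<Rightarrow> (real \<Rightarrow> real) \<Rightarrow> bool" where
  "absolutely_continuous_on a b f \<longleftrightarrow>
     (\<forall>\<epsilon>>0. \<exists>\<delta>>0. \<forall>\<D> S. \<D> division_of S \<and> S \<subseteq> {a..b} \<and> (\<Sum>k\<in>\<D>. Sup k - Inf k) < \<delta>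
        \<longrightarrow> (\<Sum>k\<in>\<D>. \<bar>f (Sup k) - f (Inf k)\<bar>) < \<epsilon>)"

definition abs_cont :: "L2 \<Rightarrow> bool" where
  "abs_cont x \<longleftrightarrow> (\<exists>f. represents f x \<and> absolutely_continuous_on 0 1 f)"

text \<open>The absolutely continuous representative, unique as a function on \<open>[0,1]\<close> if it exists;
  its values outside \<open>[0,1]\<close> are arbitrary.\<close>

definition ac_rep :: "L2 \<Rightarrow> real \<Rightarrow> real" where
  "ac_rep x = (SOME f. represents f x \<and> absolutely_continuous_on 0 1 f)"

definition has_L2_deriv :: "L2 \<Rightarrow> L2 \<Rightarrow> bool" where
  "has_L2_deriv x y \<longleftrightarrow> abs_cont x \<and>
     (\<exists>g. represents g y \<and>
        (AE t in leb01. (ac_rep x has_real_derivative g t) (at t within {0..1})))"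

text \<open>``\<open>x\<close> is absolutely continuous and \<open>x'\<close> belongs to \<open>L\<^sup>2[0,1]\<close>''\<close>

definition L2_differentiable :: "L2 \<Rightarrow> bool" where
  "L2_differentiable x \<longleftrightarrow> (\<exists>y. has_L2_deriv x y)"

definition L2_deriv :: "L2 \<Rightarrow> L2" where
  "L2_deriv x = (THE y. has_L2_deriv x y)"

lemma has_L2_deriv_unique:
  assumes "has_L2_deriv x y" "has_L2_deriv x z"
  shows "y = z"
proof -
  obtain g where g: "represents g y"
    "AE t in leb01. (ac_rep x has_real_derivative g t) (at t within {0..1})"
    using assms(1) by (auto simp: has_L2_deriv_def)
  obtain h where h: "represents h z"
    "AE t in leb01. (ac_rep x has_real_derivative h t) (at t within {0..1})"
    using assms(2) by (auto simp: has_L2_deriv_def)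
  have "AE t in leb01. t \<in> {0..1}"
    using AE_space[of leb01] by simp
  then have "AE t in leb01. g t = h t"
    using g(2) h(2)
  proof eventually_elim
    case (elim t)
    then have "at t within {0..1} \<noteq> bot"
      by (simp add: trivial_limit_within islimpt_Icc)
    then show ?case
      using elim(2,3) tendsto_unique by (simp add: has_field_derivative_iff) blast
  qed
  then have "represents g z"
    using g(1) h(1) by (transfer) (auto elim: eventually_elim2)
  with g(1) show ?thesis
    by (rule represents_unique)
qed

lemma L2_deriv_eq: "has_L2_deriv x y \<Longrightarrow> L2_deriv x = y"
  unfolding L2_deriv_def by (blast intro: has_L2_deriv_unique)

section \<open>Set-valued operators\<close>

type_synonym 'a setop = "'a \<Rightarrow> 'a set"

definition gra :: "'a setop \<Rightarrow> ('a \<times> 'a) set" where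
  "gra A = {(x, u). u \<in> A x}"

definition dom_op :: "'a setop \<Rightarrow> 'a set" where
  "dom_op A = {x. A x \<noteq> {}}"

definition ran_op :: "'a setop \<Rightarrow> 'a set" where
  "ran_op A = (\<Union>x. A x)"

definition inv_op :: "'a setop \<Rightarrow> 'a setop" where
  "inv_op A = (\<lambda>u. {x. u \<in> A x})"

text \<open>The single-valued operator \<open>f\<close> with domain \<open>D\<close>\<close>

definition op_on :: "('a \<Rightarrow> 'a) \<Rightarrow> 'a set \<Rightarrow> 'a setop" where
  "op_on f D = (\<lambda>x. if x \<in> D then {f x} else {})"

text \<open>The class operations on functions and sets would give pointwise complement and set
  difference, hence separate constants for the Minkowski operations.\<close>

definition neg_op :: "'a::real_vector setop \<Rightarrow> 'a setop" where
  "neg_op A = (\<lambda>x. {- u |u. u \<in> A x})"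

definition diff_op :: "'a::real_vector setop \<Rightarrow> 'a setop \<Rightarrow> 'a setop" where
  "diff_op A B = (\<lambda>x. {u - v |u v. u \<in> A x \<and> v \<in> B x})"

definition scale_op :: "real \<Rightarrow> 'a::real_vector setop \<Rightarrow> 'a setop" where
  "scale_op c A = (\<lambda>x. {c *\<^sub>R u |u. u \<in> A x})"

lemma dom_scale_diff_op: "dom_op (scale_op c (diff_op A B)) = dom_op A \<inter> dom_op B"
  by (auto simp: dom_op_def scale_op_def diff_op_def)

definition linear_relation :: "'a::real_vector setop \<Rightarrow> bool" where
  "linear_relation A \<longleftrightarrow> subspace (gra A)"

definition adj_op :: "'a::real_inner setop \<Rightarrow> 'a setop" where
  "adj_op A = (\<lambda>x. {u. (u, - x) \<in> orthogonal_comp (gra A)})"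

definition skew_op :: "'a::real_inner setop \<Rightarrow> bool" where
  "skew_op A \<longleftrightarrow> linear_relation A \<and> (\<forall>(x, u)\<in>gra A. x \<bullet> u = 0)"

definition monotone_op :: "'a::real_inner setop \<Rightarrow> bool" where
  "monotone_op A \<longleftrightarrow> (\<forall>(x, u)\<in>gra A. \<forall>(y, v)\<in>gra A. (x - y) \<bullet> (u - v) \<ge> 0)"

definition maximal_monotone_op :: "'a::real_inner setop \<Rightarrow> bool" where
  "maximal_monotone_op A \<longleftrightarrow> monotone_op A \<and> (\<forall>B. monotone_op B \<longrightarrow> \<not> gra A \<subset> gra B)"

definition maximal_monotone_extension :: "'a::real_inner setop \<Rightarrow> 'a setop \<Rightarrow> bool" where
  "maximal_monotone_extension B A \<longleftrightarrow> maximal_monotone_op B \<and> gra A \<subseteq> gra B"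

end

theory Submission
  imports Defs
begin

text \<open>
  Everything follows from one analytic fact: an element \<open>x\<close> of \<open>L\<^sup>2[0,1]\<close> is absolutely continuous
  with derivative \<open>y\<close> in \<open>L\<^sup>2[0,1]\<close> if and only if \<open>x = V y + c e\<close> for a real \<open>c\<close>, and then
  \<open>x(0) = c\<close> and \<open>x(1) = c + \<langle>e, y\<rangle>\<close>. One direction
  (\<open>has_L2_deriv_volterra_plus_const\<close>) is Lebesgue's differentiation theorem together with the
  absolute continuity of indefinite integrals; the other
  (\<open>has_L2_deriv_imp_volterra_plus_const\<close>) is the fact that an absolutely continuous function
  with derivative zero almost everywhere is constant.

  The rest is algebra in the inner product space, resting on the identity
  \<open>V\<^sup>* x = \<langle>e, x\<rangle> e - V x\<close> (\<open>volterra_adj_eq\<close>). Since \<open>T\<^sup>* = (V\<^sup>*)\<^sup>-\<^sup>1\<close>, a point \<open>x\<close> of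
  \<open>dom T \<inter> dom T\<^sup>*\<close> is \<open>V u = V\<^sup>* v\<close>, which forces \<open>V (u + v) = \<langle>e, v\<rangle> e\<close>, hence \<open>v = - u\<close> and
  \<open>u \<in> e\<^sup>\<bottom>\<close>. So \<open>S\<close>, \<open>T\<^sub>1\<close> and \<open>S\<^sup>*\<close> are differentiation (up to sign) with the graphs

  \<^item> \<open>S = {(V y, y) | y \<in> e\<^sup>\<bottom>}\<close>
  \<^item> \<open>T\<^sub>1 = {(V y + c e, y) | y \<in> e\<^sup>\<bottom>, c \<in> \<real>}\<close>
  \<^item> \<open>S\<^sup>* = {(V y + c e, - y) | y \<in> L\<^sup>2[0,1], c \<in> \<real>}\<close>

  the last one because a vector orthogonal to the hyperplane \<open>e\<^sup>\<bottom>\<close> is a multiple of \<open>e\<close>. On \<open>e\<^sup>\<bottom>\<close>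
  the identity makes \<open>V\<close> skew, so \<open>S\<close> and \<open>T\<^sub>1\<close> are skew. A skew relation with \<open>A\<^sup>* = - A\<close> is
  maximal monotone (\<open>skew_op_adj_eq_neg_imp_maximal\<close>); this applies to \<open>T\<^sub>1\<close> and \<open>- T\<^sub>1\<close>, and since
  \<open>(e, 0)\<close> belongs to their graphs but not to those of \<open>S\<close> and \<open>- S\<close>, the latter two are not
  maximal. Finally \<open>S\<^sup>*\<close> is not monotone in either sign because the constant \<open>c\<close> in its graph may
  have any sign.

  Density of \<open>dom S\<close> is proved by approximation: polynomials vanishing at both endpoints lie in
  \<open>V (e\<^sup>\<bottom>)\<close>, and dominated limits lead from them to all polynomials, continuous functions, bounded
  functions and finally all of \<open>L\<^sup>2[0,1]\<close>.
\<close>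

section \<open>Absolute continuity and indefinite integrals\<close>

lemma AE_leb01_iff:
  "(AE t in leb01. P t) \<longleftrightarrow> (\<exists>N. negligible N \<and> (\<forall>t\<in>{0..1}. t \<notin> N \<longrightarrow> P t))"
proof -
  have "{x. \<not> (x \<in> {0..1} \<longrightarrow> P x)} \<subseteq> N \<longleftrightarrow> (\<forall>t\<in>{0..1}. t \<notin> N \<longrightarrow> P t)" for N
    by blast
  moreover have "(AE t in leb01. P t) \<longleftrightarrow> (AE t in lebesgue. t \<in> {0..1} \<longrightarrow> P t)"
    by (rule AE_restrict_space_iff) simp
  ultimately show ?thesis
    by (simp only: eventually_ae_filter_negligible)
qed

text \<open>Lebesgue's differentiation theorem for averages over \<open>{t..t + h}\<close> gives the right derivative
  at almost every point; applied to the reflected function \<open>f (- t)\<close> it gives the left one.\<close>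

lemma indefinite_integral_has_derivative_AE:
  fixes f :: "real \<Rightarrow> real"
  assumes f: "f integrable_on {0..1}"
  shows "AE t in leb01. ((\<lambda>t. integral {0..t} f) has_real_derivative f t) (at t within {0..1})"
proof -
  \<comment> \<open>The differentiation theorem wants integrability on every box, hence extension by zero.\<close>
  define g where "g = (\<lambda>t. if t \<in> {0..1} then f t else 0)"
  have g_UNIV: "g integrable_on UNIV"
    using f unfolding g_def by (simp only: integrable_restrict_UNIV)
  then have g_int: "g integrable_on cbox a b" for a b
    by (rule integrable_on_subcbox) simp
  have "(\<lambda>x. g (- x)) integrable_on cbox a b" for a b
    using g_int[of "- b" "- a"] integrable_reflect[where f=g and a="- b" and b="- a"] by simp
  from integrable_ccontinuous_explicit[OF this] obtain N1 where N1: "negligible N1"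
    and L: "\<And>x e. \<lbrakk>x \<notin> N1; 0 < e\<rbrakk> \<Longrightarrow> \<exists>d>0. \<forall>h. 0 < h \<and> h < d \<longrightarrow>
      norm (integral (cbox x (x + h *\<^sub>R One)) (\<lambda>x. g (- x)) /\<^sub>R h ^ DIM(real) - g (- x)) < e"
    by metis
  from integrable_ccontinuous_explicit[OF g_int] obtain N2 where N2: "negligible N2"
    and R: "\<And>x e. \<lbrakk>x \<notin> N2; 0 < e\<rbrakk> \<Longrightarrow> \<exists>d>0. \<forall>h. 0 < h \<and> h < d \<longrightarrow>
      norm (integral (cbox x (x + h *\<^sub>R One)) g /\<^sub>R h ^ DIM(real) - g x) < e"
    by metis
  have "negligible (uminus ` N1)"
    using N1 by (rule negligible_locally_Lipschitz_image[OF order_refl])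
      (rule exI[of _ UNIV], rule exI[of _ 1], simp add: abs_minus_commute)
  then have "negligible (uminus ` N1 \<union> N2)"
    using N2 by simp
  moreover have "((\<lambda>t. integral {0..t} f) has_real_derivative f t) (at t within {0..1})"
    if t: "t \<in> {0..1}" "t \<notin> uminus ` N1 \<union> N2" for t
  proof -
    have nt: "- t \<notin> N1"
      using t(2) by (metis UnI1 imageI minus_minus)
    have split: "integral {0..v} f - integral {0..u} f = integral {u..v} g"
      if "0 \<le> u" "u \<le> v" "v \<le> 1" for u v
    proof -
      have "integral {0..u} f + integral {u..v} f = integral {0..v} f"
        using that by (intro Henstock_Kurzweil_Integration.integral_combine integrable_on_subinterval[OF f]) auto
      moreover have "integral {u..v} f = integral {u..v} g"
        using that by (intro Henstock_Kurzweil_Integration.integral_cong) (auto simp: g_def)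
      ultimately show ?thesis by simp
    qed
    have "\<exists>d>0. \<forall>y\<in>{0..1}. norm (y - t) < d \<longrightarrow>
        norm (integral {0..y} f - integral {0..t} f - f t * (y - t)) \<le> e * norm (y - t)"
      if e: "0 < e" for e
    proof -
      obtain d1 where d1: "d1 > 0" "\<And>h. \<lbrakk>0 < h; h < d1\<rbrakk> \<Longrightarrow>
          \<bar>integral {- t..- t + h} (\<lambda>x. g (- x)) / h - g t\<bar> < e"
        using L[OF nt e] by (auto simp: divide_inverse_commute)
      obtain d2 where d2: "d2 > 0" "\<And>h. \<lbrakk>0 < h; h < d2\<rbrakk> \<Longrightarrow>
          \<bar>integral {t..t + h} g / h - g t\<bar> < e"
        using R[of t e] t(2) e by (auto simp: divide_inverse_commute)
      have gt: "g t = f t" using t by (simp add: g_def)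
      have lin: "\<bar>I - f t * h\<bar> \<le> e * h" if "\<bar>I / h - f t\<bar> < e" "h > 0" for I h
        using that by (simp add: abs_less_iff abs_le_iff field_simps)
      show ?thesis
      proof (intro exI[of _ "min d1 d2"] conjI ballI impI)
        show "min d1 d2 > 0" using d1 d2 by simp
        fix y :: real assume y: "y \<in> {0..1}" "norm (y - t) < min d1 d2"
        consider "y = t" | "t < y" | "y < t" by linarith
        then show "norm (integral {0..y} f - integral {0..t} f - f t * (y - t)) \<le> e * norm (y - t)"
        proof cases
          case 2
          then show ?thesis
            using lin[OF d2(2)[of "y - t", unfolded gt]] split[of t y] t y by auto
        next
          case 3
          have "integral {- t..- t + (t - y)} (\<lambda>x. g (- x)) = integral {y..t} g"
            using Henstock_Kurzweil_Integration.integral_reflect_real[of t y g] by simp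
          then have "\<bar>integral {y..t} g - f t * (t - y)\<bar> \<le> e * (t - y)"
            using lin[OF d1(2)[of "t - y", unfolded gt]] 3 y by auto
          then show ?thesis
            using split[of y t] t y 3 by (auto simp: algebra_simps abs_le_iff)
        qed simp
      qed
    qed
    then show ?thesis
      by (simp add: has_field_derivative_def has_derivative_within_alt bounded_linear_mult_right)
  qed
  ultimately show ?thesis
    unfolding AE_leb01_iff by blast
qed

lemma absolutely_continuous_on_diff:
  assumes "absolutely_continuous_on a b f" "absolutely_continuous_on a b g"
  shows "absolutely_continuous_on a b (\<lambda>t. f t - g t)"
  unfolding absolutely_continuous_on_def
proof (intro allI impI)
  fix e :: real assume "e > 0"
  then have "e / 2 > 0" by simp
  obtain d1 where d1: "d1 > 0" "\<And>\<D> S. \<D> division_of S \<and> S \<subseteq> {a..b} \<and> (\<Sum>k\<in>\<D>. Sup k - Inf k) < d1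
        \<Longrightarrow> (\<Sum>k\<in>\<D>. \<bar>f (Sup k) - f (Inf k)\<bar>) < e / 2"
    using assms(1) \<open>e / 2 > 0\<close> unfolding absolutely_continuous_on_def by metis
  obtain d2 where d2: "d2 > 0" "\<And>\<D> S. \<D> division_of S \<and> S \<subseteq> {a..b} \<and> (\<Sum>k\<in>\<D>. Sup k - Inf k) < d2
        \<Longrightarrow> (\<Sum>k\<in>\<D>. \<bar>g (Sup k) - g (Inf k)\<bar>) < e / 2"
    using assms(2) \<open>e / 2 > 0\<close> unfolding absolutely_continuous_on_def by metis
  show "\<exists>d>0. \<forall>\<D> S. \<D> division_of S \<and> S \<subseteq> {a..b} \<and> (\<Sum>k\<in>\<D>. Sup k - Inf k) < d
        \<longrightarrow> (\<Sum>k\<in>\<D>. \<bar>f (Sup k) - g (Sup k) - (f (Inf k) - g (Inf k))\<bar>) < e"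
  proof (intro exI[of _ "min d1 d2"] conjI allI impI)
    fix \<D> S
    assume D: "\<D> division_of S \<and> S \<subseteq> {a..b} \<and> (\<Sum>k\<in>\<D>. Sup k - Inf k) < min d1 d2"
    have "(\<Sum>k\<in>\<D>. \<bar>f (Sup k) - g (Sup k) - (f (Inf k) - g (Inf k))\<bar>)
      \<le> (\<Sum>k\<in>\<D>. \<bar>f (Sup k) - f (Inf k)\<bar> + \<bar>g (Sup k) - g (Inf k)\<bar>)"
      by (intro sum_mono) linarith
    also have "\<dots> < e"
      using d1(2)[of \<D> S] d2(2)[of \<D> S] D by (simp add: sum.distrib)
    finally show "(\<Sum>k\<in>\<D>. \<bar>f (Sup k) - g (Sup k) - (f (Inf k) - g (Inf k))\<bar>) < e" .
  qed (use d1 d2 in simp)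
qed

lemma absolutely_continuous_on_imp_continuous_on:
  assumes "absolutely_continuous_on a b f"
  shows "continuous_on {a..b} f"
  unfolding continuous_on_iff
proof (intro ballI allI impI)
  fix x e :: real assume x: "x \<in> {a..b}" and "e > 0"
  then obtain d where d: "d > 0" "\<And>\<D> S. \<D> division_of S \<and> S \<subseteq> {a..b} \<and> (\<Sum>k\<in>\<D>. Sup k - Inf k) < d
        \<Longrightarrow> (\<Sum>k\<in>\<D>. \<bar>f (Sup k) - f (Inf k)\<bar>) < e"
    using assms unfolding absolutely_continuous_on_def by metis
  have "dist (f y) (f x) < e" if y: "y \<in> {a..b}" "dist y x < d" for y
  proof -
    let ?k = "{min x y..max x y}"
    have "{?k} division_of ?k"
      using division_of_self[of "min x y" "max x y"] by simp
    moreover have "(\<Sum>k\<in>{?k}. Sup k - Inf k) < d"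
      using y(2) by (simp add: dist_real_def)
    ultimately have "(\<Sum>k\<in>{?k}. \<bar>f (Sup k) - f (Inf k)\<bar>) < e"
      using x y by (intro d(2)[of "{?k}" ?k]) auto
    then show ?thesis
      by (cases "x \<le> y") (auto simp: dist_real_def max_def min_def)
  qed
  with d(1) show "\<exists>d>0. \<forall>x'\<in>{a..b}. dist x' x < d \<longrightarrow> dist (f x') (f x) < e"
    by blast
qed

text \<open>Square integrability gives an explicit modulus: from \<open>\<bar>s\<bar> \<le> r s\<^sup>2 + 1/r\<close>, the variation over a
  division of total length \<open>\<delta>\<close> is at most \<open>r M + \<delta>/r\<close>, where \<open>M\<close> is the integral of \<open>f\<^sup>2\<close>. First \<open>r\<close>
  and then \<open>\<delta>\<close> is taken small.\<close>

lemma absolutely_continuous_on_indefinite_integral: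
  assumes f: "f integrable_on {0..1}" and f2: "(\<lambda>t. (f t)\<^sup>2) integrable_on {0..1}"
  shows "absolutely_continuous_on 0 1 (\<lambda>t. c + integral {0..t} f)"
  unfolding absolutely_continuous_on_def
proof (intro allI impI)
  fix e :: real assume e: "e > 0"
  define M where "M = integral {0..1} (\<lambda>t. (f t)\<^sup>2)"
  have M: "0 \<le> M"
    unfolding M_def by (rule Henstock_Kurzweil_Integration.integral_nonneg[OF f2]) simp
  define r where "r = e / (2 * M + 2)"
  have r: "r > 0" "r * M < e / 2"
    using e M by (auto simp: r_def field_simps)
  have bound: "\<bar>integral {u..v} f\<bar> \<le> r * integral {u..v} (\<lambda>t. (f t)\<^sup>2) + (v - u) / r"
    if "u \<le> v" "{u..v} \<subseteq> {0..1}" for u v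
  proof -
    have fi: "f integrable_on {u..v}" and fi2: "(\<lambda>t. (f t)\<^sup>2) integrable_on {u..v}"
      using integrable_on_subinterval[OF f that(2)] integrable_on_subinterval[OF f2 that(2)] .
    have "\<bar>s\<bar> \<le> r * s\<^sup>2 + 1 / r" for s
    proof -
      have "0 \<le> (r * \<bar>s\<bar> - 1)\<^sup>2" by simp
      then have "2 * (r * \<bar>s\<bar>) \<le> r * r * s\<^sup>2 + 1"
        by (simp add: power2_eq_square algebra_simps)
      moreover have "r * \<bar>s\<bar> \<ge> 0" using r by simp
      ultimately have "r * \<bar>s\<bar> \<le> r * r * s\<^sup>2 + 1" by linarith
      with r show ?thesis by (simp add: field_simps)
    qed
    then have "norm (integral {u..v} f) \<le> integral {u..v} (\<lambda>t. r * (f t)\<^sup>2 + 1 / r)"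
      using fi fi2 by (intro integral_norm_bound_integral Henstock_Kurzweil_Integration.integrable_add integrable_on_mult_right) auto
    also have "\<dots> = r * integral {u..v} (\<lambda>t. (f t)\<^sup>2) + (v - u) / r"
      using fi2 that(1) by (subst Henstock_Kurzweil_Integration.integral_add) (auto intro!: integrable_on_mult_right)
    finally show ?thesis by simp
  qed
  show "\<exists>d>0. \<forall>\<D> S. \<D> division_of S \<and> S \<subseteq> {0..1} \<and> (\<Sum>k\<in>\<D>. Sup k - Inf k) < d
        \<longrightarrow> (\<Sum>k\<in>\<D>. \<bar>c + integral {0..Sup k} f - (c + integral {0..Inf k} f)\<bar>) < e"
  proof (intro exI[of _ "r * e / 2"] conjI allI impI)
    show "r * e / 2 > 0" using r e by simp
    fix \<D> S
    assume D: "\<D> division_of S \<and> S \<subseteq> {0..1} \<and> (\<Sum>k\<in>\<D>. Sup k - Inf k) < r * e / 2"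
    then have div: "\<D> division_of S" and S: "S \<subseteq> {0..1}" by auto
    have "\<bar>c + integral {0..Sup k} f - (c + integral {0..Inf k} f)\<bar>
        \<le> r * integral k (\<lambda>t. (f t)\<^sup>2) + (Sup k - Inf k) / r" if k: "k \<in> \<D>" for k
    proof -
      obtain u v where uv: "k = {u..v}" using division_ofD(4)[OF div k] by auto
      then have le: "u \<le> v"
        using division_ofD(3)[OF div k] by simp
      have sub: "{u..v} \<subseteq> {0..1}"
        using division_ofD(2)[OF div k] S unfolding uv by (rule order_trans)
      then have "0 \<le> u" "v \<le> 1" using le by auto
      then have "integral {0..u} f + integral {u..v} f = integral {0..v} f"
        using le by (intro Henstock_Kurzweil_Integration.integral_combine integrable_on_subinterval[OF f]) auto
      with bound[OF le sub] le show ?thesis by (simp add: uv)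
    qed
    then have "(\<Sum>k\<in>\<D>. \<bar>c + integral {0..Sup k} f - (c + integral {0..Inf k} f)\<bar>)
        \<le> (\<Sum>k\<in>\<D>. r * integral k (\<lambda>t. (f t)\<^sup>2) + (Sup k - Inf k) / r)"
      by (rule sum_mono)
    also have "\<dots> = r * (\<Sum>k\<in>\<D>. integral k (\<lambda>t. (f t)\<^sup>2)) + (\<Sum>k\<in>\<D>. Sup k - Inf k) / r"
      by (simp add: sum.distrib sum_distrib_left sum_divide_distrib)
    also have "(\<Sum>k\<in>\<D>. integral k (\<lambda>t. (f t)\<^sup>2)) \<le> M"
    proof -
      have int: "(\<lambda>t. (f t)\<^sup>2) integrable_on S"
        using integrable_on_subdivision[OF div f2 S] .
      have "(\<Sum>k\<in>\<D>. integral k (\<lambda>t. (f t)\<^sup>2)) = integral S (\<lambda>t. (f t)\<^sup>2)"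
        using integral_combine_division_topdown[OF int div] by simp
      also have "\<dots> \<le> M"
        unfolding M_def by (intro integral_subset_le[OF S int f2]) simp
      finally show ?thesis .
    qed
    also have "(\<Sum>k\<in>\<D>. Sup k - Inf k) / r < e / 2"
      using D r by (simp add: field_simps)
    finally show "(\<Sum>k\<in>\<D>. \<bar>c + integral {0..Sup k} f - (c + integral {0..Inf k} f)\<bar>) < e"
      using r by simp
  qed
qed

text \<open>Cousin's lemma supplies a tagged division of \<open>{0..x}\<close> that is fine for a gauge adapted to
  the exceptional null set \<open>N\<close>. At tags outside \<open>N\<close> the increments are at most \<open>\<epsilon>/2\<close> times the length,
  as the derivative vanishes there. The intervals tagged in \<open>N\<close> lie in an open set \<open>G \<supseteq> N\<close> of small
  measure, so that absolute continuity bounds the sum of their increments.\<close>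

lemma absolutely_continuous_on_zero_deriv_imp_const:
  assumes ac: "absolutely_continuous_on 0 1 h"
    and deriv: "AE t in leb01. (h has_real_derivative 0) (at t within {0..1})"
    and x: "x \<in> {0..1}"
  shows "h x = h 0"
proof -
  obtain N where N: "negligible N"
    and hN: "\<And>t. \<lbrakk>t \<in> {0..1}; t \<notin> N\<rbrakk> \<Longrightarrow> (h has_real_derivative 0) (at t within {0..1})"
    using deriv unfolding AE_leb01_iff by metis
  have "\<bar>h x - h 0\<bar> \<le> e" if e: "e > 0" for e
  proof -
    have e2: "e / 2 > 0" using e by simp
    obtain \<delta> where \<delta>: "\<delta> > 0"
      "\<And>\<D> S. \<D> division_of S \<and> S \<subseteq> {0..1} \<and> (\<Sum>k\<in>\<D>. Sup k - Inf k) < \<delta>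
        \<Longrightarrow> (\<Sum>k\<in>\<D>. \<bar>h (Sup k) - h (Inf k)\<bar>) < e / 2"
      using ac e2 unfolding absolutely_continuous_on_def by metis
    obtain G where G: "open G" "N \<subseteq> G" "G \<in> lmeasurable" "measure lebesgue G < \<delta>"
    proof -
      have "N \<in> sets lebesgue" using N by (simp add: negligible_imp_sets)
      from sets_lebesgue_outer_open[OF this \<delta>(1)] obtain G where
        G: "open G" "N \<subseteq> G" "G - N \<in> lmeasurable" "emeasure lebesgue (G - N) < ennreal \<delta>" .
      have Gm: "G \<in> lmeasurable"
        using fmeasurable_Diff_D[OF G(3) negligible_imp_measurable[OF N] G(2)] .
      have "measure lebesgue (G - N) = measure lebesgue G"
        using N by (intro measure_Diff_null_set) (auto simp: negligible_iff_null_sets fmeasurableD[OF Gm])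
      moreover have "measure lebesgue (G - N) < \<delta>"
        using G(3,4) \<delta>(1) by (simp add: emeasure_eq_measure2 ennreal_less_iff)
      ultimately show thesis using that G Gm by simp
    qed
    have "\<forall>t. \<exists>d>0. t \<in> {0..1} - N \<longrightarrow>
        (\<forall>y\<in>{0..1}. \<bar>y - t\<bar> < d \<longrightarrow> \<bar>h y - h t\<bar> \<le> e / 2 * \<bar>y - t\<bar>)"
    proof
      fix t
      show "\<exists>d>0. t \<in> {0..1} - N \<longrightarrow>
        (\<forall>y\<in>{0..1}. \<bar>y - t\<bar> < d \<longrightarrow> \<bar>h y - h t\<bar> \<le> e / 2 * \<bar>y - t\<bar>)"
      proof (cases "t \<in> {0..1} - N")
        case True
        then have "(h has_derivative (\<lambda>y. 0)) (at t within {0..1})"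
          using hN[of t] by (simp add: has_field_derivative_def lambda_zero)
        then obtain d where "d > 0" "\<forall>y\<in>{0..1}. norm (y - t) < d \<longrightarrow>
            norm (h y - h t - 0) \<le> e / 2 * norm (y - t)"
          using e2 unfolding has_derivative_within_alt by metis
        then show ?thesis
          by (intro exI[of _ d]) simp
      qed (auto intro: exI[of _ 1])
    qed
    then obtain d where d: "\<And>t. d t > 0" "\<And>t y. \<lbrakk>t \<in> {0..1} - N; y \<in> {0..1}; \<bar>y - t\<bar> < d t\<rbrakk>
        \<Longrightarrow> \<bar>h y - h t\<bar> \<le> e / 2 * \<bar>y - t\<bar>"
      by metis
    define \<gamma> where "\<gamma> t = (if t \<in> N then G else ball t (d t))" for t
    have "gauge \<gamma>"
      using G d(1) by (auto simp: gauge_def \<gamma>_def)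
    then obtain p where p: "p tagged_division_of {0..x}" "\<gamma> fine p"
      by (rule fine_division_exists_real)
    define q where "q = {(t, k) \<in> p. t \<in> N}"
    have fin: "finite p" using p(1) by blast
    have pk: "\<exists>u v. k = {u..v} \<and> u \<le> t \<and> t \<le> v \<and> 0 \<le> u \<and> v \<le> 1" if tk: "(t, k) \<in> p" for t k
    proof -
      obtain u v where uv: "k = {u..v}"
        using tagged_division_ofD(4)[OF p(1) tk] by auto
      have t: "t \<in> {u..v}" "{u..v} \<subseteq> {0..x}"
        using tagged_division_ofD(2,3)[OF p(1) tk] unfolding uv by blast+
      then have "u \<in> {0..x}" "v \<in> {0..x}" by auto
      with uv t(1) x show ?thesis by auto
    qed
    have "h x - h 0 = (\<Sum>(t, k)\<in>p. h (Sup k) - h (Inf k))"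
      using additive_tagged_division_1[of 0 x p h] p(1) x by simp
    also have "\<dots> = (\<Sum>(t, k)\<in>q. h (Sup k) - h (Inf k)) + (\<Sum>(t, k)\<in>p - q. h (Sup k) - h (Inf k))"
      using fin by (subst sum.subset_diff[of q p]) (auto simp: q_def)
    finally have "\<bar>h x - h 0\<bar> \<le> \<bar>\<Sum>(t, k)\<in>q. h (Sup k) - h (Inf k)\<bar>
        + \<bar>\<Sum>(t, k)\<in>p - q. h (Sup k) - h (Inf k)\<bar>"
      by linarith
    also have "\<bar>\<Sum>(t, k)\<in>q. h (Sup k) - h (Inf k)\<bar> \<le> e / 2"
    proof -
      have q: "q tagged_partial_division_of {0..x}"
        using p(1) unfolding tagged_division_of_def
        by (auto simp: q_def intro: tagged_partial_division_subset)
      define S where "S = \<Union>(snd ` q)"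
      have qd: "q tagged_division_of S"
        unfolding S_def using q by (rule tagged_partial_division_of_Union_self)
      have div: "snd ` q division_of S"
        unfolding S_def by (rule partial_division_of_tagged_division[OF q])
      have len: "Sup k - Inf k = measure lebesgue k \<and> k \<in> lmeasurable" if "k \<in> snd ` q" for k
        using that pk by (force simp: q_def)
      have S: "S \<subseteq> {0..1}" "S \<subseteq> G"
        using pk p(2) by (fastforce simp: S_def q_def fine_def \<gamma>_def)+
      have "(\<Sum>k\<in>snd ` q. Sup k - Inf k) = (\<Sum>k\<in>snd ` q. measure lebesgue k)"
        using len by (intro sum.cong) auto
      also have "\<dots> = measure lebesgue S"
        using content_division[OF div] by simp
      also have "\<dots> \<le> measure lebesgue G"
        using S(2) G(3) lmeasurable_division[OF div] by (intro measure_mono_fmeasurable) auto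
      finally have "(\<Sum>k\<in>snd ` q. \<bar>h (Sup k) - h (Inf k)\<bar>) < e / 2"
        using G(4) S(1) div by (intro \<delta>(2)[of _ S]) auto
      moreover have "(\<Sum>(t, k)\<in>q. h (Sup k) - h (Inf k)) = (\<Sum>k\<in>snd ` q. h (Sup k) - h (Inf k))"
      \<comment> \<open>Passing from tagged intervals to intervals needs a summand that vanishes on empty ones.\<close>
      proof -
        let ?d = "\<lambda>k. if k = {} then 0 else h (Sup k) - h (Inf k)"
        have "(\<Sum>(t, k)\<in>q. ?d k) = (\<Sum>k\<in>snd ` q. ?d k)"
          by (rule sum.over_tagged_division_lemma[OF qd]) (auto simp: le_less)
        moreover have "k \<noteq> {}" if "(t, k) \<in> q" for t k
          using tagged_partial_division_ofD(2)[OF q that] by blast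
        then have "(\<Sum>(t, k)\<in>q. ?d k) = (\<Sum>(t, k)\<in>q. h (Sup k) - h (Inf k))"
          "(\<Sum>k\<in>snd ` q. ?d k) = (\<Sum>k\<in>snd ` q. h (Sup k) - h (Inf k))"
          by (auto intro!: sum.cong)
        ultimately show ?thesis by simp
      qed
      moreover have "\<bar>\<Sum>k\<in>snd ` q. h (Sup k) - h (Inf k)\<bar> \<le> (\<Sum>k\<in>snd ` q. \<bar>h (Sup k) - h (Inf k)\<bar>)"
        by (rule sum_abs)
      ultimately show ?thesis by linarith
    qed
    also have "\<bar>\<Sum>(t, k)\<in>p - q. h (Sup k) - h (Inf k)\<bar> \<le> e / 2"
    proof -
      have "\<bar>\<Sum>(t, k)\<in>p - q. h (Sup k) - h (Inf k)\<bar>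
          \<le> (\<Sum>(t, k)\<in>p - q. \<bar>h (Sup k) - h (Inf k)\<bar>)"
        by (rule order_trans[OF sum_abs]) (simp add: case_prod_unfold)
      also have "\<dots> \<le> (\<Sum>(t, k)\<in>p - q. e / 2 * (Sup k - Inf k))"
      proof (rule sum_mono, clarify)
        fix t k assume tk: "(t, k) \<in> p" "(t, k) \<notin> q"
        then have t: "t \<notin> N" by (simp add: q_def)
        obtain u v where uv: "k = {u..v}" "u \<le> t" "t \<le> v" "0 \<le> u" "v \<le> 1"
          using pk[OF tk(1)] by blast
        have "{u..v} \<subseteq> ball t (d t)"
          using p(2) tk(1) t uv(1) by (force simp: fine_def \<gamma>_def)
        moreover have "u \<in> {u..v}" "v \<in> {u..v}" using uv by auto
        ultimately have "u \<in> ball t (d t)" "v \<in> ball t (d t)" by blast+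
        then have "\<bar>u - t\<bar> < d t" "\<bar>v - t\<bar> < d t"
          by (simp_all add: dist_real_def abs_minus_commute)
        then have "\<bar>h u - h t\<bar> \<le> e / 2 * \<bar>u - t\<bar>" "\<bar>h v - h t\<bar> \<le> e / 2 * \<bar>v - t\<bar>"
          using d(2)[of t u] d(2)[of t v] t uv by auto
        moreover have "\<bar>u - t\<bar> = t - u" "\<bar>v - t\<bar> = v - t" using uv by simp_all
        ultimately have "\<bar>h u - h t\<bar> \<le> e / 2 * (t - u)" "\<bar>h v - h t\<bar> \<le> e / 2 * (v - t)"
          by metis+
        then have "\<bar>h v - h u\<bar> \<le> e / 2 * (t - u) + e / 2 * (v - t)"
          by linarith
        also have "\<dots> = e / 2 * (v - u)" by (simp flip: distrib_left)
        finally show "\<bar>h (Sup k) - h (Inf k)\<bar> \<le> e / 2 * (Sup k - Inf k)"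
          using uv by simp
      qed
      also have "\<dots> \<le> (\<Sum>(t, k)\<in>p. e / 2 * (Sup k - Inf k))"
        using fin pk e by (intro sum_mono2) force+
      also have "\<dots> = e / 2 * (\<Sum>(t, k)\<in>p. Sup k - Inf k)"
        by (simp add: sum_distrib_left case_prod_unfold)
      also have "(\<Sum>(t, k)\<in>p. Sup k - Inf k) = x"
        using additive_tagged_division_1[of 0 x p "\<lambda>t. t"] p(1) x by simp
      also have "e / 2 * x \<le> e / 2"
        using x e by simp
      finally show ?thesis .
    qed
    finally show ?thesis by simp
  qed
  then have "\<bar>h x - h 0\<bar> \<le> 0"
    by (rule field_le_epsilon) simp
  then show ?thesis by simp
qed

section \<open>Representatives, the Volterra operator and the derivative\<close>

lemma L2_abs_exists: "\<exists>g. square_integrable g \<and> x = abs_L2 g"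
  by (rule L2.abs_induct[of _ x]) auto

text \<open>Representation is the transfer relation of the quotient, so the transfer rules of the lifted
  operations say what represents their results.\<close>

lemma represents_iff_pcr: "represents f x \<longleftrightarrow> pcr_L2 f x"
proof -
  obtain g where g: "square_integrable g" "x = abs_L2 g"
    using L2_abs_exists by blast
  have "represents f x \<longleftrightarrow> square_integrable f \<and> (AE t in leb01. f t = g t)"
    unfolding g(2) using represents.abs_eq[of g f] g(1) by simp
  moreover have "pcr_L2 f x \<longleftrightarrow> square_integrable f \<and> (AE t in leb01. f t = g t)"
    using Quotient_rel[OF Quotient_L2, of f g] g by (auto simp: L2.pcr_cr_eq cr_L2_def)
  ultimately show ?thesis by simp
qed

lemma represents_exists: "\<exists>f. represents f x"
  using L2_abs_exists[of x] by (auto simp: represents_iff_pcr L2.pcr_cr_eq cr_L2_def)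

lemma represents_square_integrable: "represents f x \<Longrightarrow> square_integrable f"
  by transfer simp

lemma square_integrable_represents: "square_integrable f \<Longrightarrow> \<exists>x. represents f x"
  by (auto simp: represents_iff_pcr L2.pcr_cr_eq cr_L2_def)

lemma represents_AE_eq: "represents f x \<Longrightarrow> represents g x \<Longrightarrow> AE t in leb01. f t = g t"
  by transfer (auto elim: eventually_elim2)

lemma represents_cong_AE:
  "represents f x \<Longrightarrow> square_integrable g \<Longrightarrow> AE t in leb01. f t = g t \<Longrightarrow> represents g x"
  by transfer (auto elim: eventually_elim2)

lemma represents_add: "represents f x \<Longrightarrow> represents g y \<Longrightarrow> represents (\<lambda>t. f t + g t) (x + y)"
  unfolding represents_iff_pcr using plus_L2.transfer unfolding rel_fun_def by blast

lemma represents_minus: "represents f x \<Longrightarrow> represents (\<lambda>t. - f t) (- x)"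
  unfolding represents_iff_pcr using uminus_L2.transfer unfolding rel_fun_def by blast

lemma represents_diff: "represents f x \<Longrightarrow> represents g y \<Longrightarrow> represents (\<lambda>t. f t - g t) (x - y)"
  using represents_add[OF _ represents_minus, of f x g y] by simp

lemma represents_scaleR: "represents f x \<Longrightarrow> represents (\<lambda>t. c * f t) (c *\<^sub>R x)"
  unfolding represents_iff_pcr using scaleR_L2.transfer unfolding rel_fun_def by blast

lemma represents_const: "represents (\<lambda>t. c) (c *\<^sub>R const_L2 1)"
proof -
  have "represents (\<lambda>t. 1) (const_L2 1)"
    unfolding represents_iff_pcr using const_L2.transfer by (auto dest!: rel_funD)
  from represents_scaleR[OF this, of c] show ?thesis by simp
qed

lemma inner_represents:
  "represents f x \<Longrightarrow> represents g y \<Longrightarrow> x \<bullet> y = (LINT t|leb01. f t * g t)"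
  unfolding represents_iff_pcr
  using inner_L2.transfer[THEN rel_funD, THEN rel_funD, of f x g y] by simp

text \<open>The bridge from Lebesgue integrals, in which the operators are defined, to Henstock--Kurzweil
  integrals, for which the calculus on intervals is stated.\<close>

lemma square_integrable_HK:
  assumes "square_integrable f"
  shows "f integrable_on {0..1}" "(\<lambda>t. (f t)\<^sup>2) integrable_on {0..1}"
    "(LINT t|leb01. f t) = integral {0..1} f"
    "t \<in> {0..1} \<Longrightarrow> (LINT s:{0..t}|lebesgue. f s) = integral {0..t} f"
    "t \<in> {0..1} \<Longrightarrow> (LINT s:{t..1}|lebesgue. f s) = integral {t..1} f"
proof -
  have i: "integrable leb01 f" "integrable leb01 (\<lambda>t. (f t)\<^sup>2)"
    using square_integrable_integrable[OF assms] assms by (auto simp: square_integrable_def)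
  then show "f integrable_on {0..1}" "(\<lambda>t. (f t)\<^sup>2) integrable_on {0..1}"
    by (simp_all add: integrable_on_lebesgue_on)
  show "(LINT t|leb01. f t) = integral {0..1} f"
    using i(1) by (rule lebesgue_integral_eq_integral) simp
  have s: "set_integrable lebesgue {0..1} f"
    using i(1) by (simp add: set_integrable_def integrable_restrict_space)
  show "(LINT s:{0..t}|lebesgue. f s) = integral {0..t} f"
    "(LINT s:{t..1}|lebesgue. f s) = integral {t..1} f" if "t \<in> {0..1}"
    using that by (auto intro!: set_lebesgue_integral_eq_integral set_integrable_subset[OF s])
qed

lemma represents_volterra:
  assumes "represents f x"
  shows "represents (\<lambda>t. integral {0..t} f) (volterra x)"
proof -
  have sq: "square_integrable f"
    using assms by (rule represents_square_integrable)
  have r: "represents (\<lambda>t. LINT s:{0..t}|lebesgue. f s) (volterra x)"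
    using assms unfolding represents_iff_pcr using volterra.transfer by (auto dest!: rel_funD)
  have eq: "(LINT s:{0..t}|lebesgue. f s) = integral {0..t} f" if "t \<in> space leb01" for t
    using that square_integrable_HK(4)[OF sq] by simp
  have "(\<lambda>t. integral {0..t} f) \<in> borel_measurable leb01 \<longleftrightarrow>
      (\<lambda>t. LINT s:{0..t}|lebesgue. f s) \<in> borel_measurable leb01"
    by (intro measurable_cong) (simp add: eq)
  moreover have "integrable leb01 (\<lambda>t. (integral {0..t} f)\<^sup>2) \<longleftrightarrow>
      integrable leb01 (\<lambda>t. (LINT s:{0..t}|lebesgue. f s)\<^sup>2)"
    by (intro Bochner_Integration.integrable_cong) (simp_all add: eq)
  ultimately have "square_integrable (\<lambda>t. integral {0..t} f)"
    using represents_square_integrable[OF r] by (simp only: square_integrable_def)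
  then show ?thesis
    using represents_cong_AE[OF r _ AE_I2[OF eq]] by blast
qed

text \<open>The two integrals over \<open>[0,t]\<close> and \<open>[t,1]\<close> add up to \<open>\<langle>e, x\<rangle>\<close>. The algebra of all the
  operators below rests on this identity.\<close>

lemma volterra_adj_eq: "volterra_adj x = (const_L2 1 \<bullet> x) *\<^sub>R const_L2 1 - volterra x"
proof -
  obtain f where f: "represents f x" using represents_exists by blast
  have sq: "square_integrable f" using f by (rule represents_square_integrable)
  have 1: "represents (\<lambda>t. LINT s:{t..1}|lebesgue. f s) (volterra_adj x)"
    using f unfolding represents_iff_pcr using volterra_adj.transfer by (auto dest!: rel_funD)
  have ip: "const_L2 1 \<bullet> x = integral {0..1} f"
    using inner_represents[OF represents_const[of 1] f] square_integrable_HK(3)[OF sq] by simp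
  have 2: "represents (\<lambda>t. integral {0..1} f - integral {0..t} f)
      ((const_L2 1 \<bullet> x) *\<^sub>R const_L2 1 - volterra x)"
    unfolding ip by (intro represents_diff represents_const represents_volterra f)
  have "AE t in leb01. integral {0..1} f - integral {0..t} f = (LINT s:{t..1}|lebesgue. f s)"
  proof (rule AE_I2)
    fix t assume "t \<in> space leb01"
    then have t: "t \<in> {0..1}" by simp
    then have "integral {0..t} f + integral {t..1} f = integral {0..1} f"
      by (intro Henstock_Kurzweil_Integration.integral_combine square_integrable_HK(1)[OF sq]) auto
    then show "integral {0..1} f - integral {0..t} f = (LINT s:{t..1}|lebesgue. f s)"
      using square_integrable_HK(5)[OF sq t] by simp
  qed
  then have "represents (\<lambda>t. LINT s:{t..1}|lebesgue. f s)
      ((const_L2 1 \<bullet> x) *\<^sub>R const_L2 1 - volterra x)"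
    by (rule represents_cong_AE[OF 2 represents_square_integrable[OF 1]])
  with 1 show ?thesis by (rule represents_unique)
qed

text \<open>The complement of a null set is dense in \<open>[0,1]\<close>. This makes the absolutely continuous
  representative unique on \<open>[0,1]\<close>, whichever one the choice in its definition picks.\<close>

lemma continuous_on_AE_eq_imp_eq:
  fixes f g :: "real \<Rightarrow> real"
  assumes "continuous_on {0..1} f" "continuous_on {0..1} g" "AE t in leb01. f t = g t"
    and t: "t \<in> {0..1}"
  shows "f t = g t"
proof -
  obtain N where N: "negligible N" and eq: "\<And>t. \<lbrakk>t \<in> {0..1}; t \<notin> N\<rbrakk> \<Longrightarrow> f t = g t"
    using assms(3) unfolding AE_leb01_iff by metis
  have "{0..1} \<subseteq> closure ({0..1} - N)"
  proof
    fix x :: real assume x: "x \<in> {0..1}"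
    show "x \<in> closure ({0..1} - N)"
      unfolding closure_approachable
    proof (intro allI impI)
      fix e :: real assume "e > 0"
      then have "max 0 (x - e) < min 1 (x + e)" using x by auto
      then have "\<not> {max 0 (x - e)<..<min 1 (x + e)} \<subseteq> N"
        using negligible_subset[OF N] open_not_negligible[OF open_greaterThanLessThan]
        by (metis greaterThanLessThan_empty_iff not_le)
      then obtain y where "y \<in> {max 0 (x - e)<..<min 1 (x + e)}" "y \<notin> N" by blast
      then show "\<exists>y\<in>{0..1} - N. dist y x < e"
        by (intro bexI[of _ y]) (auto simp: dist_real_def)
    qed
  qed
  moreover have "closure ({0..1} - N) \<subseteq> {0..1}"
    by (intro closure_minimal) auto
  ultimately have cl: "closure ({0..1} - N) = {0..1}" by blast
  have "f t - g t = 0"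
    by (rule continuous_constant_on_closure[of "{0..1} - N" "\<lambda>t. f t - g t"])
      (use assms t eq in \<open>auto simp: cl intro!: continuous_intros\<close>)
  then show ?thesis by simp
qed

lemma ac_rep_properties:
  assumes "abs_cont x"
  shows "represents (ac_rep x) x" "absolutely_continuous_on 0 1 (ac_rep x)"
  using someI_ex[OF assms[unfolded abs_cont_def]] by (simp_all add: ac_rep_def)

lemma volterra_plus_const_AC:
  assumes "represents g y"
  shows "represents (\<lambda>t. c + integral {0..t} g) (volterra y + c *\<^sub>R const_L2 1)"
    "absolutely_continuous_on 0 1 (\<lambda>t. c + integral {0..t} g)"
  using represents_add[OF represents_const represents_volterra[OF assms], of c]
    absolutely_continuous_on_indefinite_integral square_integrable_HK
    represents_square_integrable[OF assms] by (simp_all add: add.commute)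

lemma ac_rep_volterra_plus_const:
  assumes g: "represents g y" and t: "t \<in> {0..1}"
  shows "ac_rep (volterra y + c *\<^sub>R const_L2 1) t = c + integral {0..t} g"
proof -
  let ?x = "volterra y + c *\<^sub>R const_L2 1"
  note F = volterra_plus_const_AC[OF g, of c]
  have ac: "abs_cont ?x" unfolding abs_cont_def using F by blast
  show ?thesis
  proof (rule continuous_on_AE_eq_imp_eq[OF _ _ _ t])
    show "AE t in leb01. ac_rep ?x t = c + integral {0..t} g"
      by (rule represents_AE_eq[OF ac_rep_properties(1)[OF ac] F(1)])
  qed (intro absolutely_continuous_on_imp_continuous_on F(2) ac_rep_properties(2)[OF ac])+
qed

lemma has_L2_deriv_volterra_plus_const:
  "has_L2_deriv (volterra y + c *\<^sub>R const_L2 1) y"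
proof -
  let ?x = "volterra y + c *\<^sub>R const_L2 1"
  obtain g where g: "represents g y" using represents_exists by blast
  have ac: "abs_cont ?x"
    unfolding abs_cont_def using volterra_plus_const_AC[OF g] by blast
  have "AE t in leb01. ((\<lambda>t. integral {0..t} g) has_real_derivative g t) (at t within {0..1})"
    by (intro indefinite_integral_has_derivative_AE square_integrable_HK(1)
        represents_square_integrable[OF g])
  then have "AE t in leb01. (ac_rep ?x has_real_derivative g t) (at t within {0..1})"
    using AE_space
  proof eventually_elim
    case (elim t)
    have "((\<lambda>t. c + integral {0..t} g) has_real_derivative g t) (at t within {0..1})"
      using elim(1) by (auto intro!: derivative_eq_intros)
    then show ?case
      by (rule has_field_derivative_transform_within[where d=1])
        (use elim(2) ac_rep_volterra_plus_const[OF g] in auto)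
  qed
  with ac g show ?thesis unfolding has_L2_deriv_def by blast
qed

text \<open>The absolutely continuous representative and the indefinite integral of its derivative have the
  same derivative almost everywhere, so their difference is constant.\<close>

lemma has_L2_deriv_imp_volterra_plus_const:
  assumes "has_L2_deriv x y"
  shows "x = volterra y + ac_rep x 0 *\<^sub>R const_L2 1"
proof -
  obtain g where g: "represents g y"
    and deriv: "AE t in leb01. (ac_rep x has_real_derivative g t) (at t within {0..1})"
    and ac: "abs_cont x"
    using assms unfolding has_L2_deriv_def by blast
  let ?c = "ac_rep x 0"
  note F = volterra_plus_const_AC[OF g, of ?c]
  let ?h = "\<lambda>t. ac_rep x t - (?c + integral {0..t} g)"
  have const: "?h t = 0" if "t \<in> {0..1}" for t
  proof -
    have "?h t = ?h 0"
    proof (rule absolutely_continuous_on_zero_deriv_imp_const[OF _ _ that])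
      show "absolutely_continuous_on 0 1 ?h"
        by (intro absolutely_continuous_on_diff ac_rep_properties(2)[OF ac] F(2))
      have "AE t in leb01. ((\<lambda>t. integral {0..t} g) has_real_derivative g t) (at t within {0..1})"
        by (intro indefinite_integral_has_derivative_AE square_integrable_HK(1)
            represents_square_integrable[OF g])
      with deriv show "AE t in leb01. (?h has_real_derivative 0) (at t within {0..1})"
        by eventually_elim (auto intro!: derivative_eq_intros)
    qed
    then show ?thesis by simp
  qed
  have "AE t in leb01. ac_rep x t = ?c + integral {0..t} g"
  proof (rule AE_I2)
    fix t assume "t \<in> space leb01"
    then show "ac_rep x t = ?c + integral {0..t} g"
      using const[of t] by (simp only: space_restrict_space space_completion space_lborel space_borel Int_UNIV_right right_minus_eq)
  qed
  then have "represents (\<lambda>t. ?c + integral {0..t} g) x"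
    by (rule represents_cong_AE[OF ac_rep_properties(1)[OF ac] represents_square_integrable[OF F(1)]])
  then show ?thesis
    using F(1) by (rule represents_unique)
qed

lemma ac_rep_endpoints:
  "ac_rep (volterra y + c *\<^sub>R const_L2 1) 0 = c"
  "ac_rep (volterra y + c *\<^sub>R const_L2 1) 1 = c + const_L2 1 \<bullet> y"
proof -
  obtain g where g: "represents g y" using represents_exists by blast
  show "ac_rep (volterra y + c *\<^sub>R const_L2 1) 0 = c"
    using ac_rep_volterra_plus_const[OF g, of 0] by simp
  show "ac_rep (volterra y + c *\<^sub>R const_L2 1) 1 = c + const_L2 1 \<bullet> y"
    using ac_rep_volterra_plus_const[OF g, of 1] inner_represents[OF represents_const[of 1] g]
      square_integrable_HK(3)[OF represents_square_integrable[OF g]] by simp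
qed

text \<open>Having an adjoint makes \<open>V\<close> linear: both sides have the same inner products with every element.\<close>

lemma volterra_linear:
  "volterra (x + y) = volterra x + volterra y"
  "volterra (c *\<^sub>R x) = c *\<^sub>R volterra x"
  by (simp_all add: vector_eq_rdot[symmetric] inner_volterra inner_add_left)

lemma volterra_minus: "volterra (- x) = - volterra x"
  using volterra_linear(2)[of "- 1" x] by simp

lemma volterra_0: "volterra 0 = 0"
  using volterra_linear(2)[of 0 0] by simp

lemma inner_const_L2: "const_L2 1 \<bullet> const_L2 1 = 1"
  using inner_represents[OF represents_const[of 1] represents_const[of 1]] square_integrable_HK(3)[OF square_integrable_const[of 1]]
  by simp

text \<open>The derivative recovers \<open>y\<close> and the value at \<open>0\<close> recovers \<open>c\<close>.\<close>

lemma volterra_plus_const_inject: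
  "volterra y + c *\<^sub>R const_L2 1 = volterra z + d *\<^sub>R const_L2 1 \<longleftrightarrow> y = z \<and> c = d"
  using has_L2_deriv_unique[OF has_L2_deriv_volterra_plus_const[of y c]]
    has_L2_deriv_volterra_plus_const[of z d] ac_rep_endpoints(1)[of y c] ac_rep_endpoints(1)[of z d]
  by metis

lemma volterra_inject: "volterra y = volterra z \<longleftrightarrow> y = z"
  using volterra_plus_const_inject[of y 0 z 0] by simp

lemma L2_differentiable_iff: "L2_differentiable x \<longleftrightarrow> (\<exists>y c. x = volterra y + c *\<^sub>R const_L2 1)"
  unfolding L2_differentiable_def
  using has_L2_deriv_volterra_plus_const has_L2_deriv_imp_volterra_plus_const by metis

lemma L2_deriv_volterra_plus_const: "L2_deriv (volterra y + c *\<^sub>R const_L2 1) = y"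
  by (intro L2_deriv_eq has_L2_deriv_volterra_plus_const)

section \<open>Density of the functions vanishing at both endpoints\<close>

lemma continuous_on_imp_square_integrable:
  assumes "continuous_on {0..1} f"
  shows "square_integrable f"
proof -
  have "integrable leb01 (\<lambda>t. (f t)\<^sup>2)"
    using assms by (intro continuous_imp_integrable_real continuous_intros)
  moreover have "f \<in> borel_measurable leb01"
    using assms by (intro continuous_imp_measurable_on_sets_lebesgue) auto
  ultimately show ?thesis by (simp add: square_integrable_def)
qed

lemma L2_dominated_convergence:
  assumes X: "\<And>n. represents (f n) (X n)" and x: "represents g x" and w: "square_integrable w"
    and lim: "AE t in leb01. (\<lambda>n. f n t) \<longlonglongrightarrow> g t"
    and bound: "\<And>n. AE t in leb01. \<bar>f n t\<bar> \<le> w t"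
  shows "X \<longlonglongrightarrow> x"
proof -
  have meas: "f n \<in> borel_measurable leb01" "g \<in> borel_measurable leb01" for n
    using represents_square_integrable[OF X] represents_square_integrable[OF x]
    by (simp_all add: square_integrable_def)
  have "AE t in leb01. \<forall>n. \<bar>f n t\<bar> \<le> w t"
    using bound by (simp add: AE_all_countable)
  with lim have gw: "AE t in leb01. \<bar>g t\<bar> \<le> w t"
  proof eventually_elim
    case (elim t)
    then show ?case
      by (intro tendsto_upperbound[OF tendsto_rabs[OF elim(1)]]) auto
  qed
  have "(\<lambda>n. LINT t|leb01. (f n t - g t)\<^sup>2) \<longlonglongrightarrow> (LINT t|leb01. 0)"
  proof (rule integral_dominated_convergence)
    show "integrable leb01 (\<lambda>t. 4 * (w t)\<^sup>2)"
      using w by (simp add: square_integrable_def)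
    show "AE t in leb01. (\<lambda>n. (f n t - g t)\<^sup>2) \<longlonglongrightarrow> 0"
      using lim
    proof eventually_elim
      case (elim t)
      have "(\<lambda>n. (f n t - g t)\<^sup>2) \<longlonglongrightarrow> (g t - g t)\<^sup>2"
        by (intro tendsto_intros elim)
      then show ?case by simp
    qed
    show "AE t in leb01. norm ((f n t - g t)\<^sup>2) \<le> 4 * (w t)\<^sup>2" for n
      using bound[of n] gw
    proof eventually_elim
      case (elim t)
      then have "\<bar>f n t - g t\<bar> \<le> 2 * w t" by linarith
      from power_mono[OF this, of 2] show ?case by (simp add: power_mult_distrib)
    qed
  qed (use meas in measurable)
  moreover have "(LINT t|leb01. (f n t - g t)\<^sup>2) = (norm (X n - x))\<^sup>2" for n
    unfolding power2_norm_eq_inner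
    using inner_represents[OF represents_diff[OF X x] represents_diff[OF X x], of n]
    by (simp add: power2_eq_square)
  ultimately have "(\<lambda>n. (norm (X n - x))\<^sup>2) \<longlonglongrightarrow> 0" by simp
  from tendsto_real_sqrt[OF this] have "(\<lambda>n. norm (X n - x)) \<longlonglongrightarrow> 0" by simp
  then show ?thesis
    by (rule LIM_zero_cancel[OF tendsto_norm_zero_cancel])
qed

text \<open>The form of dominated convergence in which the density proof climbs from one class of functions
  to the next.\<close>

lemma closed_dominated_limit:
  assumes C: "closed C" and f: "\<And>n. \<exists>x\<in>C. represents (f n) x"
    and g: "square_integrable g" and w: "square_integrable w"
    and lim: "AE t in leb01. (\<lambda>n. f n t) \<longlonglongrightarrow> g t"
    and bound: "\<And>n t. t \<in> {0..1} \<Longrightarrow> \<bar>f n t\<bar> \<le> w t"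
  shows "\<exists>x\<in>C. represents g x"
proof -
  obtain X where X: "\<And>n. X n \<in> C" "\<And>n. represents (f n) (X n)"
    using f by metis
  obtain x where x: "represents g x"
    using square_integrable_represents[OF g] by blast
  have "X \<longlonglongrightarrow> x"
    using X(2) x w lim
  proof (rule L2_dominated_convergence)
    show "AE t in leb01. \<bar>f n t\<bar> \<le> w t" for n
      by (rule AE_I2) (simp add: bound)
  qed
  then have "x \<in> C"
    using X(1) by (intro Lim_in_closed_set[OF C]) auto
  with x show ?thesis by blast
qed

text \<open>By the fundamental theorem of calculus \<open>q = V q'\<close> when \<open>q(0) = 0\<close>, and then \<open>\<langle>e, q'\<rangle> = q(1)\<close>.\<close>

lemma polynomial_vanishing_at_endpoints_in_range:
  assumes q: "real_polynomial_function q" "q 0 = 0" "q 1 = 0"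
  shows "\<exists>x\<in>{volterra y |y. const_L2 1 \<bullet> y = 0}. represents q x"
proof -
  obtain q' where q': "real_polynomial_function q'"
    "\<And>t. (q has_real_derivative q' t) (at t)"
    using has_real_derivative_polynomial_function[OF q(1)] by blast
  have "square_integrable q'"
    using q'(1) by (intro continuous_on_imp_square_integrable continuous_on_polymonial_function)
      (simp add: real_polynomial_function_eq)
  then obtain y where y: "represents q' y"
    using square_integrable_represents by blast
  have int: "integral {0..t} q' = q t" if "t \<in> {0..1}" for t
  proof -
    have "(q' has_integral q t - q 0) {0..t}"
      using that q'(2) by (intro fundamental_theorem_of_calculus)
        (auto simp flip: has_real_derivative_iff_has_vector_derivative
          intro: has_field_derivative_at_within)
    then show ?thesis using q(2) by (simp add: integral_unique)
  qed
  have "const_L2 1 \<bullet> y = 0"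
    using inner_represents[OF represents_const[of 1] y] int[of 1] q(3)
      square_integrable_HK(3)[OF represents_square_integrable[OF y]] by simp
  moreover have "represents q (volterra y)"
  proof (rule represents_cong_AE[OF represents_volterra[OF y]])
    show "square_integrable q"
      using q(1) by (intro continuous_on_imp_square_integrable continuous_on_polymonial_function)
        (simp add: real_polynomial_function_eq)
    show "AE t in leb01. integral {0..t} q' = q t"
      by (rule AE_I2) (simp add: int)
  qed
  ultimately show ?thesis by blast
qed

lemma volterra_orthogonal_const_dense:
  "closure {volterra y |y. const_L2 1 \<bullet> y = 0} = UNIV"
proof -
  define C where "C = closure {volterra y |y. const_L2 1 \<bullet> y = 0}"
  have C: "closed C" by (simp add: C_def)
  \<comment> \<open>The factor \<open>1 - (2 t - 1)\<^sup>2\<^sup>n\<close> is a polynomial with values in \<open>[0,1]\<close> that vanishes at \<open>0\<close> and \<open>1\<close> and tends to \<open>1\<close> between them.\<close>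
  have poly: "\<exists>x\<in>C. represents p x" if p: "real_polynomial_function p" for p
  proof (rule closed_dominated_limit[OF C, where f = "\<lambda>n t. p t * (1 - (2 * t - 1) ^ (2 * n))"
        and w = "\<lambda>t. \<bar>p t\<bar>"])
    have cp: "continuous_on {0..1} p"
      using p by (intro continuous_on_polymonial_function) (simp add: real_polynomial_function_eq)
    show "square_integrable p" "square_integrable (\<lambda>t. \<bar>p t\<bar>)"
      using cp by (auto intro!: continuous_on_imp_square_integrable continuous_intros)
    show "\<exists>x\<in>C. represents (\<lambda>t. p t * (1 - (2 * t - 1) ^ (2 * n))) x" for n
    proof -
      have "real_polynomial_function (\<lambda>t::real. t)"
        by (intro real_polynomial_function.intros(1) bounded_linear_ident)
      then have "real_polynomial_function (\<lambda>t. p t * (1 - (2 * t - 1) ^ (2 * n)))"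
        using p by (intro real_polynomial_function.intros(4) real_polynomial_function_diff
            real_polynomial_function_power real_polynomial_function.intros(2))
      then have "\<exists>x\<in>{volterra y |y. const_L2 1 \<bullet> y = 0}.
          represents (\<lambda>t. p t * (1 - (2 * t - 1) ^ (2 * n))) x"
        by (rule polynomial_vanishing_at_endpoints_in_range) simp_all
      then show ?thesis
        unfolding C_def using closure_subset by (meson subsetD)
    qed
    show "AE t in leb01. (\<lambda>n. p t * (1 - (2 * t - 1) ^ (2 * n))) \<longlonglongrightarrow> p t"
      unfolding AE_leb01_iff
    proof (intro exI[of _ "{0, 1}"] conjI ballI impI)
      fix t :: real assume t: "t \<in> {0..1}" "t \<notin> {0, 1}"
      then have "(2 * t - 1)\<^sup>2 < 1"
        by (auto simp: abs_square_less_1)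
      then have "(\<lambda>n. ((2 * t - 1)\<^sup>2) ^ n) \<longlonglongrightarrow> 0"
        by (rule LIMSEQ_realpow_zero[rotated]) simp
      then have "(\<lambda>n. p t * (1 - ((2 * t - 1)\<^sup>2) ^ n)) \<longlonglongrightarrow> p t * (1 - 0)"
        by (rule tendsto_mult[OF tendsto_const tendsto_diff[OF tendsto_const]])
      then show "(\<lambda>n. p t * (1 - (2 * t - 1) ^ (2 * n))) \<longlonglongrightarrow> p t"
        by (simp add: power_mult)
    qed simp
    show "\<bar>p t * (1 - (2 * t - 1) ^ (2 * n))\<bar> \<le> \<bar>p t\<bar>" if "t \<in> {0..1}" for n t
    proof -
      have "(2 * t - 1)\<^sup>2 \<le> 1"
        using that by (auto simp: abs_square_le_1)
      then have "((2 * t - 1)\<^sup>2) ^ n \<le> 1" "0 \<le> ((2 * t - 1)\<^sup>2) ^ n"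
        by (auto intro: power_le_one)
      then have "\<bar>1 - (2 * t - 1) ^ (2 * n)\<bar> \<le> 1"
        by (simp add: power_mult)
      then show ?thesis
        by (simp add: abs_mult mult_left_le)
    qed
  qed
  have cont: "\<exists>x\<in>C. represents h x" if h: "continuous_on {0..1} h" for h
  proof -
    have "\<exists>p. real_polynomial_function p \<and> (\<forall>t\<in>{0..1}. \<bar>h t - p t\<bar> < inverse (Suc n))" for n
      using Stone_Weierstrass_real_polynomial_function[OF compact_Icc h, of "inverse (Suc n)"]
      by (metis inverse_positive_iff_positive of_nat_0_less_iff zero_less_Suc)
    then obtain p where p: "\<And>n. real_polynomial_function (p n)"
      "\<And>n t. t \<in> {0..1} \<Longrightarrow> \<bar>h t - p n t\<bar> < inverse (Suc n)"
      by metis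
    show ?thesis
    proof (rule closed_dominated_limit[OF C, where f = p and w = "\<lambda>t. \<bar>h t\<bar> + 1"])
      show "square_integrable h" "square_integrable (\<lambda>t. \<bar>h t\<bar> + 1)"
        using h by (auto intro!: continuous_on_imp_square_integrable continuous_intros)
      show "\<exists>x\<in>C. represents (p n) x" for n
        using poly[OF p(1)] .
      show "AE t in leb01. (\<lambda>n. p n t) \<longlonglongrightarrow> h t"
      proof (rule AE_I2)
        fix t assume "t \<in> space leb01"
        then have "norm (p n t - h t) \<le> inverse (Suc n)" for n
          using p(2)[of t n] by (simp add: abs_minus_commute)
        then have "(\<lambda>n. p n t - h t) \<longlonglongrightarrow> 0"
          by (intro Lim_null_comparison[OF _ LIMSEQ_inverse_real_of_nat] always_eventually) simp
        then show "(\<lambda>n. p n t) \<longlonglongrightarrow> h t" by (rule LIM_zero_cancel)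
      qed
      show "\<bar>p n t\<bar> \<le> \<bar>h t\<bar> + 1" if "t \<in> {0..1}" for n t
      proof -
        have "inverse (real (Suc n)) \<le> 1" by (simp add: field_simps)
        then show ?thesis using p(2)[OF that, of n] by linarith
      qed
    qed
  qed
  \<comment> \<open>Truncation makes the continuous approximants of a measurable function uniformly bounded.\<close>
  define clamp where "clamp k s = max (- real k) (min (real k) s)" for k :: nat and s
  have clamp_bound: "\<bar>clamp k s\<bar> \<le> \<bar>s\<bar>" "\<bar>clamp k s\<bar> \<le> k" for k s
    by (auto simp: clamp_def)
  have "x \<in> C" for x
  proof -
    obtain f where f: "represents f x" using represents_exists by blast
    then have sq: "square_integrable f" by (rule represents_square_integrable)
    have bdd: "\<exists>x\<in>C. represents (\<lambda>t. clamp k (f t)) x" for k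
    proof -
      have "f measurable_on {0..1}"
        using sq by (simp add: measurable_on_iff_borel_measurable square_integrable_def)
      then obtain N g where N: "negligible N" and g: "\<And>n. continuous_on UNIV (g n)"
        and lim: "\<And>t. t \<notin> N \<Longrightarrow> (\<lambda>n. g n t) \<longlonglongrightarrow> (if t \<in> {0..1} then f t else 0)"
        unfolding measurable_on_def by metis
      show ?thesis
      proof (rule closed_dominated_limit[OF C, where f = "\<lambda>n t. clamp k (g n t)" and w = "\<lambda>t. real k"])
        show "square_integrable (\<lambda>t. real k)" by (rule square_integrable_const)
        show "square_integrable (\<lambda>t. clamp k (f t))"
          unfolding square_integrable_def
        proof
          show m: "(\<lambda>t. clamp k (f t)) \<in> borel_measurable leb01"
            using sq unfolding clamp_def square_integrable_def
            by (intro borel_measurable_max borel_measurable_min borel_measurable_const) simp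
          show "integrable leb01 (\<lambda>t. (clamp k (f t))\<^sup>2)"
          proof (rule Bochner_Integration.integrable_bound)
            show "integrable leb01 (\<lambda>t. (f t)\<^sup>2)" using sq by (simp add: square_integrable_def)
            show "(\<lambda>t. (clamp k (f t))\<^sup>2) \<in> borel_measurable leb01" using m by (rule borel_measurable_power)
            show "AE t in leb01. norm ((clamp k (f t))\<^sup>2) \<le> norm ((f t)\<^sup>2)"
              using clamp_bound(1) by (intro AE_I2) (simp add: abs_le_square_iff)
          qed
        qed
        show "\<exists>x\<in>C. represents (\<lambda>t. clamp k (g n t)) x" for n
          unfolding clamp_def
          by (intro cont continuous_intros continuous_on_subset[OF g]) auto
        show "AE t in leb01. (\<lambda>n. clamp k (g n t)) \<longlonglongrightarrow> clamp k (f t)"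
          unfolding AE_leb01_iff
        proof (intro exI[of _ N] conjI N ballI impI)
          fix t :: real assume "t \<in> {0..1}" "t \<notin> N"
          then have "(\<lambda>n. g n t) \<longlonglongrightarrow> f t" using lim[of t] by simp
          then show "(\<lambda>n. clamp k (g n t)) \<longlonglongrightarrow> clamp k (f t)"
            unfolding clamp_def by (intro tendsto_intros)
        qed
        show "\<bar>clamp k (g n t)\<bar> \<le> real k" for n t by (rule clamp_bound(2))
      qed
    qed
    have "\<exists>x\<in>C. represents f x"
    proof (rule closed_dominated_limit[OF C, where f = "\<lambda>k t. clamp k (f t)" and w = "\<lambda>t. \<bar>f t\<bar>"])
      show "square_integrable (\<lambda>t. \<bar>f t\<bar>)"
        using sq by (simp add: square_integrable_def borel_measurable_abs)
      show "AE t in leb01. (\<lambda>k. clamp k (f t)) \<longlonglongrightarrow> f t"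
      proof (rule AE_I2)
        fix t
        obtain K :: nat where "\<bar>f t\<bar> \<le> K" using real_arch_simple by blast
        then have "clamp k (f t) = f t" if "k \<ge> K" for k
          using that by (auto simp: clamp_def)
        then show "(\<lambda>k. clamp k (f t)) \<longlonglongrightarrow> f t"
          by (intro tendsto_eventually) (auto simp: eventually_sequentially)
      qed
    qed (use sq bdd clamp_bound(1) in auto)
    then show ?thesis using f represents_unique by blast
  qed
  then show ?thesis by (auto simp: C_def)
qed

section \<open>Adjoints, skewness and maximal monotonicity\<close>

lemma mem_adj_op_iff: "u \<in> adj_op A x \<longleftrightarrow> (\<forall>a b. b \<in> A a \<longrightarrow> a \<bullet> u = b \<bullet> x)"
  by (auto simp: adj_op_def orthogonal_comp_def orthogonal_def gra_def)

text \<open>Testing \<open>z\<close> against its own component in the hyperplane \<open>e\<^sup>\<bottom>\<close> shows that this component is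
  orthogonal to itself.\<close>

lemma orthogonal_to_hyperplane:
  fixes e :: "'a::real_inner"
  assumes e: "e \<bullet> e = 1" and z: "\<And>w. e \<bullet> w = 0 \<Longrightarrow> w \<bullet> z = 0"
  shows "z = (e \<bullet> z) *\<^sub>R e"
proof -
  define w where "w = z - (e \<bullet> z) *\<^sub>R e"
  have ew: "e \<bullet> w = 0"
    by (simp add: w_def inner_diff_right e)
  have "w \<bullet> w = w \<bullet> z - (e \<bullet> z) * (e \<bullet> w)"
    by (subst (2) w_def) (simp add: inner_diff_right inner_commute)
  then have "w = 0" using z[OF ew] ew by simp
  then show ?thesis by (simp add: w_def)
qed

lemma skew_op_imp_monotone:
  assumes "skew_op A"
  shows "monotone_op A"
  unfolding monotone_op_def
proof clarify
  fix x u y v assume "(x, u) \<in> gra A" "(y, v) \<in> gra A"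
  then have "(x - y, u - v) \<in> gra A"
    using assms subspace_diff[of "gra A" "(x, u)" "(y, v)"] by (simp add: skew_op_def linear_relation_def)
  then show "0 \<le> (x - y) \<bullet> (u - v)"
    using assms by (auto simp: skew_op_def)
qed

lemma skew_op_neg:
  assumes "skew_op A"
  shows "skew_op (neg_op A)"
proof -
  have mem: "(x, u) \<in> gra (neg_op A) \<longleftrightarrow> (x, - u) \<in> gra A" for x u
    by (force simp: gra_def neg_op_def)
  have sub: "subspace (gra A)" and skew: "\<And>x u. (x, u) \<in> gra A \<Longrightarrow> x \<bullet> u = 0"
    using assms by (auto simp: skew_op_def linear_relation_def)
  show ?thesis
    unfolding skew_op_def linear_relation_def
  proof (intro conjI subspaceI)
    show "0 \<in> gra (neg_op A)"
      using subspace_0[OF sub] by (simp add: zero_prod_def mem)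
    show "p + q \<in> gra (neg_op A)" if "p \<in> gra (neg_op A)" "q \<in> gra (neg_op A)" for p q
      using that subspace_add[OF sub, of "(fst p, - snd p)" "(fst q, - snd q)"]
      by (cases p, cases q) (simp add: mem)
    show "c *\<^sub>R p \<in> gra (neg_op A)" if "p \<in> gra (neg_op A)" for c p
      using that subspace_scale[OF sub, of "(fst p, - snd p)" c]
      by (cases p) (simp add: mem)
    show "\<forall>(x, u)\<in>gra (neg_op A). x \<bullet> u = 0"
      using skew by (auto simp: mem) (metis inner_minus_right neg_equal_0_iff_equal)
  qed
qed

text \<open>If \<open>(x, u)\<close> is monotonically related to every point of the graph of \<open>A\<close>, skewness reduces the
  condition at \<open>s (a, b)\<close> to \<open>s (\<langle>x, b\<rangle> + \<langle>a, u\<rangle>) \<le> \<langle>x, u\<rangle>\<close>. As \<open>s\<close> is an arbitrary real, the bracket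
  vanishes, which says that \<open>- u\<close> is in \<open>A\<^sup>* x = - A x\<close>.\<close>

lemma skew_op_adj_eq_neg_imp_maximal:
  assumes skew: "skew_op A" and adj: "adj_op A = neg_op A"
  shows "maximal_monotone_op A"
  unfolding maximal_monotone_op_def
proof (intro conjI allI impI notI)
  show "monotone_op A" using skew by (rule skew_op_imp_monotone)
  fix B assume B: "monotone_op B" and AB: "gra A \<subset> gra B"
  have sub: "subspace (gra A)" and sk: "\<And>x u. (x, u) \<in> gra A \<Longrightarrow> x \<bullet> u = 0"
    using skew by (auto simp: skew_op_def linear_relation_def)
  have "(x, u) \<in> gra A" if xu: "(x, u) \<in> gra B" for x u
  proof -
    have lin: "x \<bullet> b + a \<bullet> u = 0" if ab: "(a, b) \<in> gra A" for a b
    proof -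
      have le: "s * (x \<bullet> b + a \<bullet> u) \<le> x \<bullet> u" for s
      proof -
        have s: "(s *\<^sub>R a, s *\<^sub>R b) \<in> gra A"
          using subspace_scale[OF sub ab, of s] by simp
        then have "0 \<le> (x - s *\<^sub>R a) \<bullet> (u - s *\<^sub>R b)"
          using B xu AB unfolding monotone_op_def by blast
        also have "\<dots> = x \<bullet> u - s * (x \<bullet> b + a \<bullet> u) + (s *\<^sub>R a) \<bullet> (s *\<^sub>R b)"
          by (simp add: inner_diff_left inner_diff_right algebra_simps)
        finally show ?thesis using sk[OF ab] by simp
      qed
      show ?thesis
      proof (rule ccontr)
        assume "x \<bullet> b + a \<bullet> u \<noteq> 0"
        then show False
          \<comment> \<open>This multiple of the graph point turns the bound into \<open>\<langle>x, u\<rangle> + 1 \<le> \<langle>x, u\<rangle>\<close>.\<close>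
          using le[of "(x \<bullet> u + 1) / (x \<bullet> b + a \<bullet> u)"] by simp
      qed
    qed
    have "a \<bullet> (- u) = b \<bullet> x" if "b \<in> A a" for a b
      using lin[of a b] that by (simp add: gra_def inner_commute)
    then have "- u \<in> adj_op A x"
      by (simp add: mem_adj_op_iff)
    then show ?thesis
      by (auto simp: adj neg_op_def gra_def)
  qed
  with AB show False by auto
qed

lemma adj_op_neg_op: "adj_op (neg_op A) = neg_op (adj_op A)"
proof (rule ext)
  fix x
  have "u \<in> adj_op (neg_op A) x \<longleftrightarrow> - u \<in> adj_op A x" for u
    unfolding mem_adj_op_iff neg_op_def by (force simp: minus_equation_iff)
  then show "adj_op (neg_op A) x = neg_op (adj_op A) x"
    by (force simp: neg_op_def)
qed

section \<open>The operators \<open>S\<close>, \<open>S\<^sup>*\<close> and \<open>T\<^sub>1\<close>\<close>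

theorem theorem4p6:
  fixes V :: "L2 \<Rightarrow> L2" and T S T1 :: "L2 setop" and e :: L2 and eperp :: "L2 set"
  assumes V: "V = volterra"
    and T: "T = inv_op (op_on V UNIV)"
    and S: "S = scale_op (1/2) (diff_op T (adj_op T))"
    and e: "e = const_L2 1"
    and eperp: "eperp = {y. e \<bullet> y = 0}"
    and T1: "T1 = op_on L2_deriv {x. L2_differentiable x \<and> ac_rep x 0 = ac_rep x 1}"
  shows
    \<comment> \<open>(i)\<close>
    "((\<forall>x\<in>dom_op S. L2_differentiable x \<and> S x = {L2_deriv x})
      \<and> gra S = {(V x, x) |x. x \<in> eperp}
      \<and> dom_op S = {x. L2_differentiable x \<and> ac_rep x 0 = 0 \<and> ac_rep x 1 = 0}
      \<and> ran_op S = eperp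
      \<and> closure (dom_op S) = UNIV
      \<and> inv_op S = op_on V eperp
      \<and> inv_op (neg_op S) = op_on (adjoint V) eperp
      \<and> skew_op S
      \<and> \<not> maximal_monotone_op S
      \<and> \<not> maximal_monotone_op (neg_op S))
    \<and>
    \<comment> \<open>(ii)\<close>
     (gra (adj_op S) = {(adjoint V u + l *\<^sub>R e, u) |u l. True}
      \<and> (\<forall>x\<in>dom_op (adj_op S). L2_differentiable x \<and> adj_op S x = {- L2_deriv x})
      \<and> dom_op (adj_op S) = {x. L2_differentiable x}
      \<and> ran_op (adj_op S) = UNIV
      \<and> \<not> monotone_op (adj_op S)
      \<and> \<not> monotone_op (neg_op (adj_op S))
      \<and> adj_op (adj_op S) = S)
    \<and>
    \<comment> \<open>(iii)\<close>
     (adj_op T1 = neg_op T1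
      \<and> ran_op T1 = eperp
      \<and> skew_op T1
      \<and> maximal_monotone_extension T1 S
      \<and> skew_op (neg_op T1)
      \<and> maximal_monotone_extension (neg_op T1) (neg_op S))"
proof -
  have adjV: "adjoint V = volterra_adj"
    by (simp add: V adjoint_volterra)
  have ee: "e \<bullet> e = 1"
    by (simp add: e inner_const_L2)
  have Vadj: "volterra_adj x = (e \<bullet> x) *\<^sub>R e - V x" for x
    by (simp add: V e volterra_adj_eq)
  have inner_V: "V x \<bullet> y = x \<bullet> volterra_adj y" for x y
    by (simp add: V inner_volterra)
  have V_lin: "V (x + y) = V x + V y" "V (c *\<^sub>R x) = c *\<^sub>R V x" "V (- x) = - V x" "V 0 = 0" for x y c
    by (simp_all add: V volterra_linear volterra_minus volterra_0)
  have V_inj: "V y + c *\<^sub>R e = V z + d *\<^sub>R e \<longleftrightarrow> y = z \<and> c = d" for y z c d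
    by (simp add: V e volterra_plus_const_inject)
  have V_inj0: "V y = V z \<longleftrightarrow> y = z" for y z
    by (simp add: V volterra_inject)
  have diff_iff: "L2_differentiable x \<longleftrightarrow> (\<exists>y c. x = V y + c *\<^sub>R e)" for x
    by (simp add: V e L2_differentiable_iff)
  have deriv: "L2_deriv (V y + c *\<^sub>R e) = y" for y c
    by (simp add: V e L2_deriv_volterra_plus_const)
  have ends: "ac_rep (V y + c *\<^sub>R e) 0 = c" "ac_rep (V y + c *\<^sub>R e) 1 = c + e \<bullet> y" for y c
    by (simp_all add: V e ac_rep_endpoints)

  \<comment> \<open>The graphs of the operators; \<open>v = - u\<close> in the one for \<open>S\<close> comes from uniqueness in \<open>V y + c e\<close>.\<close>
  have T_mem: "u \<in> T x \<longleftrightarrow> x = V u" for x u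
    by (simp add: T inv_op_def op_on_def)
  have adjT_mem: "v \<in> adj_op T x \<longleftrightarrow> x = volterra_adj v" for x v
    unfolding mem_adj_op_iff T_mem using vector_eq_ldot[of "volterra_adj v" x]
    by (auto simp: inner_V)
  have S_mem: "y \<in> S x \<longleftrightarrow> e \<bullet> y = 0 \<and> x = V y" for x y
  proof
    assume "y \<in> S x"
    then obtain u v where uv: "y = (1/2) *\<^sub>R (u - v)" "x = V u" "x = volterra_adj v"
      by (auto simp: S scale_op_def diff_op_def T_mem adjT_mem)
    then have "V (u + v) + 0 *\<^sub>R e = V 0 + (e \<bullet> v) *\<^sub>R e"
      by (simp add: Vadj V_lin algebra_simps)
    then have "u + v = 0" "e \<bullet> v = 0"
      unfolding V_inj by simp_all
    then have "v = - u" "e \<bullet> u = 0"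
      by (auto simp: add_eq_0_iff)
    moreover from this have "y = u"
      using uv(1) by (simp flip: scaleR_2)
    ultimately show "e \<bullet> y = 0 \<and> x = V y"
      using uv(2) by simp
  next
    assume y: "e \<bullet> y = 0 \<and> x = V y"
    then have "x = volterra_adj (- y)"
      by (simp add: Vadj V_lin)
    moreover have "y = (1/2) *\<^sub>R (y - - y)"
      by (simp flip: scaleR_2)
    ultimately show "y \<in> S x"
      using y unfolding S scale_op_def diff_op_def T_mem[symmetric] adjT_mem[symmetric] by blast
  qed
  have adjS_mem: "u \<in> adj_op S x \<longleftrightarrow> (\<exists>l. x = volterra_adj u + l *\<^sub>R e)" for u x
  proof
    assume "u \<in> adj_op S x"
    then have "w \<bullet> (x - volterra_adj u) = 0" if "e \<bullet> w = 0" for w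
      using that by (simp add: mem_adj_op_iff S_mem inner_V inner_diff_right)
    from orthogonal_to_hyperplane[OF ee this]
    have "x = volterra_adj u + (e \<bullet> (x - volterra_adj u)) *\<^sub>R e"
      by (simp add: algebra_simps)
    then show "\<exists>l. x = volterra_adj u + l *\<^sub>R e" ..
  next
    assume "\<exists>l. x = volterra_adj u + l *\<^sub>R e"
    then show "u \<in> adj_op S x"
      by (auto simp: mem_adj_op_iff S_mem inner_V inner_add_right inner_commute[of _ e])
  qed
  have adjS_mem': "u \<in> adj_op S x \<longleftrightarrow> (\<exists>c. x = V (- u) + c *\<^sub>R e)" for u x
  proof -
    have "volterra_adj u + l *\<^sub>R e = V (- u) + (e \<bullet> u + l) *\<^sub>R e" for l
      by (simp add: Vadj V_lin algebra_simps)
    then show ?thesis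
      unfolding adjS_mem by (metis add_diff_cancel_left' diff_add_cancel add.commute)
  qed
  have T1_mem: "y \<in> T1 x \<longleftrightarrow> e \<bullet> y = 0 \<and> (\<exists>c. x = V y + c *\<^sub>R e)" for x y
    unfolding T1 op_on_def by (auto simp: diff_iff deriv ends split: if_splits)

  \<comment> \<open>\<open>S\<close> and \<open>T\<^sub>1\<close> differ in the constants that they admit, \<open>{0}\<close> or all reals.\<close>
  have gra_skew: "skew_op A" if mem: "\<And>x y. y \<in> A x \<longleftrightarrow> e \<bullet> y = 0 \<and> (\<exists>c\<in>C. x = V y + c *\<^sub>R e)"
    and C: "subspace C" for A C
    unfolding skew_op_def linear_relation_def
  proof (intro conjI subspaceI)
    show "0 \<in> gra A"
      using subspace_0[OF C] by (auto simp: zero_prod_def gra_def mem V_lin intro!: bexI[of _ 0])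
    show "p + q \<in> gra A" if "p \<in> gra A" "q \<in> gra A" for p q
    proof -
      obtain c d where "c \<in> C" "d \<in> C" "e \<bullet> snd p = 0" "e \<bullet> snd q = 0"
        "fst p = V (snd p) + c *\<^sub>R e" "fst q = V (snd q) + d *\<^sub>R e"
        using \<open>p \<in> gra A\<close> \<open>q \<in> gra A\<close> by (auto simp: gra_def mem)
      then show ?thesis
        by (auto simp: gra_def mem V_lin inner_add_right algebra_simps case_prod_beta
            intro!: bexI[of _ "c + d"] subspace_add[OF C])
    qed
    show "r *\<^sub>R p \<in> gra A" if "p \<in> gra A" for r p
    proof -
      obtain c where "c \<in> C" "e \<bullet> snd p = 0" "fst p = V (snd p) + c *\<^sub>R e"
        using \<open>p \<in> gra A\<close> by (auto simp: gra_def mem)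
      then show ?thesis
        using subspace_scale[OF C, of c r]
        by (auto simp: gra_def mem V_lin algebra_simps case_prod_beta intro!: bexI[of _ "r * c"])
    qed
    show "\<forall>(x, u)\<in>gra A. x \<bullet> u = 0"
    proof clarify
      fix x u assume "(x, u) \<in> gra A"
      then obtain c where u: "e \<bullet> u = 0" "x = V u + c *\<^sub>R e"
        by (auto simp: gra_def mem)
      have "V u \<bullet> u = - (V u \<bullet> u)"
        using inner_V[of u u] u(1) by (simp add: Vadj inner_diff_right inner_commute)
      then show "x \<bullet> u = 0" using u by (simp add: inner_add_left)
    qed
  qed
  have skewS: "skew_op S"
    by (rule gra_skew[of S "{0}"]) (auto simp: S_mem)
  have skewT1: "skew_op T1"
    by (rule gra_skew[of T1 UNIV]) (auto simp: T1_mem)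
  have adjT1: "adj_op T1 = neg_op T1"
  proof -
    have "u \<in> adj_op T1 x \<longleftrightarrow> - u \<in> T1 x" for u x
    proof
      assume u: "u \<in> adj_op T1 x"
      have 1: "(V w + c *\<^sub>R e) \<bullet> u = w \<bullet> x" if "e \<bullet> w = 0" for w c
        using u that unfolding mem_adj_op_iff T1_mem by blast
      have eu: "e \<bullet> u = 0"
        using 1[of 0 1] by (simp add: V_lin)
      have "u \<in> adj_op S x"
        using 1[of _ 0] by (auto simp: mem_adj_op_iff S_mem)
      with eu show "- u \<in> T1 x"
        by (simp add: adjS_mem' T1_mem)
    next
      assume "- u \<in> T1 x"
      then have eu: "e \<bullet> u = 0" and "u \<in> adj_op S x"
        by (auto simp: adjS_mem' T1_mem)
      then show "u \<in> adj_op T1 x"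
        by (auto simp: mem_adj_op_iff S_mem T1_mem inner_add_left)
    qed
    then show ?thesis
      by (intro ext) (force simp: neg_op_def)
  qed
  have maxT1: "maximal_monotone_op T1"
    using skewT1 adjT1 by (rule skew_op_adj_eq_neg_imp_maximal)
  have max_negT1: "maximal_monotone_op (neg_op T1)"
    by (rule skew_op_adj_eq_neg_imp_maximal[OF skew_op_neg[OF skewT1]])
      (simp add: adj_op_neg_op adjT1)
  have sub: "gra S \<subseteq> gra T1"
    by (auto simp: gra_def S_mem T1_mem intro: exI[of _ 0])
  have neg_sub: "gra (neg_op S) \<subseteq> gra (neg_op T1)"
    using sub by (auto simp: gra_def neg_op_def)
  \<comment> \<open>The constant \<open>e\<close> has derivative zero and equal values at both ends, but does not vanish there.\<close>
  have e_T1: "(e, 0) \<in> gra T1" "(e, 0) \<in> gra (neg_op T1)"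
    by (auto simp: gra_def T1_mem V_lin neg_op_def intro: exI[of _ 1])
  have "e \<noteq> V 0"
    using ee by (auto simp: V_lin)
  then have e_S: "(e, 0) \<notin> gra S" "(e, 0) \<notin> gra (neg_op S)"
    by (auto simp: gra_def S_mem neg_op_def)

  have domS: "x \<in> dom_op S \<longleftrightarrow> (\<exists>y. e \<bullet> y = 0 \<and> x = V y)" for x
    by (auto simp: dom_op_def S_mem)
  have domS': "dom_op S = {x. L2_differentiable x \<and> ac_rep x 0 = 0 \<and> ac_rep x 1 = 0}"
  proof (intro set_eqI iffI CollectI)
    fix x assume "x \<in> dom_op S"
    then obtain y where y: "e \<bullet> y = 0" "x = V y + 0 *\<^sub>R e" by (auto simp: domS)
    then show "L2_differentiable x \<and> ac_rep x 0 = 0 \<and> ac_rep x 1 = 0"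
    proof -
      have "L2_differentiable x" using y(2) diff_iff by blast
      then show ?thesis using y ends[of y 0] by simp
    qed
  next
    fix x assume x: "x \<in> {x. L2_differentiable x \<and> ac_rep x 0 = 0 \<and> ac_rep x 1 = 0}"
    then obtain y c where "x = V y + c *\<^sub>R e" using diff_iff by blast
    with x ends[of y c] show "x \<in> dom_op S" by (auto simp: domS)
  qed
  have domadjS: "x \<in> dom_op (adj_op S) \<longleftrightarrow> L2_differentiable x" for x
    unfolding dom_op_def diff_iff using adjS_mem'[of _ x] by (simp add: ex_in_conv[symmetric]) (metis minus_minus)
  \<comment> \<open>Against \<open>(0, 0)\<close>, the points with \<open>y = - e\<close> give \<open>\<langle>V (- e), e\<rangle> + c\<close>, of either sign as \<open>c\<close> varies.\<close>
  have "\<not> monotone_op (adj_op S) \<and> \<not> monotone_op (neg_op (adj_op S))"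
  proof -
    have g: "(V (- e) + c *\<^sub>R e, e) \<in> gra (adj_op S)" "(0, 0) \<in> gra (adj_op S)" for c
      by (auto simp: gra_def adjS_mem' V_lin intro: exI[of _ 0])
    then have g': "(V (- e) + c *\<^sub>R e, - e) \<in> gra (neg_op (adj_op S))" "(0, 0) \<in> gra (neg_op (adj_op S))" for c
      by (force simp: gra_def neg_op_def)+
    have ip: "(V (- e) + c *\<^sub>R e) \<bullet> e = V (- e) \<bullet> e + c" for c
      by (simp add: inner_add_left ee)
    show ?thesis
    proof (intro conjI notI)
      assume "monotone_op (adj_op S)"
      then have "0 \<le> (V (- e) + c *\<^sub>R e - 0) \<bullet> (e - 0)" for c
        using g unfolding monotone_op_def by blast
      from this[of "- (V (- e) \<bullet> e) - 1"] ip show False by simp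
    next
      assume "monotone_op (neg_op (adj_op S))"
      then have "0 \<le> (V (- e) + c *\<^sub>R e - 0) \<bullet> (- e - 0)" for c
        using g' unfolding monotone_op_def by blast
      from this[of "- (V (- e) \<bullet> e) + 1"] ip show False by simp
    qed
  qed
  moreover have "adj_op (adj_op S) = S"
  proof -
    have "u \<in> adj_op (adj_op S) x \<longleftrightarrow> u \<in> S x" for u x
    proof
      assume u: "u \<in> adj_op (adj_op S) x"
      have 1: "(volterra_adj w + l *\<^sub>R e) \<bullet> u = w \<bullet> x" for w l
        using u unfolding mem_adj_op_iff[of _ "adj_op S"] adjS_mem by blast
      have "e \<bullet> u = 0"
        using 1[of 0 1] by (simp add: Vadj V_lin)
      moreover have "w \<bullet> V u = w \<bullet> x" for w
        using 1[of w 0] inner_V[of u w] by (simp add: inner_commute)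
      then have "V u = x" using vector_eq_ldot by blast
      ultimately show "u \<in> S x" by (simp add: S_mem)
    next
      assume "u \<in> S x"
      then show "u \<in> adj_op (adj_op S) x"
        by (auto simp: mem_adj_op_iff[of _ "adj_op S"] adjS_mem S_mem inner_add_left)
          (metis inner_V inner_commute)
    qed
    then show ?thesis by blast
  qed
  moreover have "\<forall>x\<in>dom_op (adj_op S). L2_differentiable x \<and> adj_op S x = {- L2_deriv x}"
  proof
    fix x assume "x \<in> dom_op (adj_op S)"
    then obtain y c where x: "x = V y + c *\<^sub>R e" and d: "L2_differentiable x"
      by (auto simp: domadjS diff_iff)
    have "u \<in> adj_op S x \<longleftrightarrow> u = - y" for u
      by (auto simp: adjS_mem' x V_inj)
    with d show "L2_differentiable x \<and> adj_op S x = {- L2_deriv x}"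
      by (auto simp: x deriv)
  qed
  moreover have "\<forall>x\<in>dom_op S. L2_differentiable x \<and> S x = {L2_deriv x}"
  proof
    fix x assume "x \<in> dom_op S"
    then obtain y where x: "e \<bullet> y = 0" "x = V y" by (auto simp: domS)
    then have "x = V y + 0 *\<^sub>R e" by simp
    then have "L2_differentiable x" "L2_deriv x = y"
      using diff_iff deriv by blast+
    moreover have "S x = {y}"
      using x by (auto simp: S_mem V_inj0)
    ultimately show "L2_differentiable x \<and> S x = {L2_deriv x}" by simp
  qed
  moreover have "closure (dom_op S) = UNIV"
  proof -
    have "dom_op S = {volterra y |y. const_L2 1 \<bullet> y = 0}"
      using domS by (auto simp: V e)
    then show ?thesis by (simp add: volterra_orthogonal_const_dense)
  qed
  moreover have "inv_op (neg_op S) = op_on (adjoint V) eperp"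
    by (rule ext) (auto simp: inv_op_def neg_op_def op_on_def eperp adjV Vadj S_mem V_lin intro: exI[of _ "- _"])
  moreover have "gra S = {(V x, x) |x. x \<in> eperp}" "ran_op S = eperp" "inv_op S = op_on V eperp"
    by (auto simp: fun_eq_iff gra_def ran_op_def inv_op_def op_on_def S_mem eperp)
  moreover have "gra (adj_op S) = {(adjoint V u + l *\<^sub>R e, u) |u l. True}"
    by (auto simp: gra_def adjS_mem adjV)
  moreover have "ran_op (adj_op S) = UNIV"
  proof -
    have "u \<in> adj_op S (volterra_adj u + 0 *\<^sub>R e)" for u
      unfolding adjS_mem by blast
    then show ?thesis unfolding ran_op_def by blast
  qed
  moreover have "dom_op (adj_op S) = {x. L2_differentiable x}"
    using domadjS by blast
  moreover have "ran_op T1 = eperp"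
  proof -
    have "y \<in> T1 (V y + 0 *\<^sub>R e)" if "e \<bullet> y = 0" for y
      using that unfolding T1_mem by blast
    moreover have "e \<bullet> y = 0" if "y \<in> T1 x" for x y
      using that by (simp add: T1_mem)
    ultimately show ?thesis unfolding ran_op_def eperp by blast
  qed
  moreover have "gra S \<subset> gra T1" "gra (neg_op S) \<subset> gra (neg_op T1)"
    using sub neg_sub e_T1 e_S by blast+
  then have "\<not> maximal_monotone_op S" "\<not> maximal_monotone_op (neg_op S)"
    using maxT1 max_negT1 by (auto simp only: maximal_monotone_op_def)
  moreover have "maximal_monotone_extension T1 S" "maximal_monotone_extension (neg_op T1) (neg_op S)"
    using maxT1 max_negT1 sub neg_sub by (simp_all only: maximal_monotone_extension_def simp_thms)
  ultimately show ?thesis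
    using domS' skewS skewT1 skew_op_neg[OF skewT1] adjT1 by (intro conjI; (assumption | blast))
qed

end
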